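(* There exists a Dirichlet series $D$, absolutely convergent in $\mathbb{C}_+$, with partial sums $S_N D$, having the following property: for every entire function $g$ there exists a sequence $(\lambda_n)$ of positive integers such that for every $\ell\in\{0,1,2,\ldots\}$ the derivatives $(S_{\lambda_n}D)^{(\ell)}$ converge to $g^{(\ell)}$ uniformly on each compact subset of the closed left half plane $\{s\in\mathbb{C}:\operatorname{Re}s\le 0\}$, as $n\to\infty$. Moreover, the set of all Dirichlet series $D$ with this property is dense and a $G_\delta$ in the space $D_a(\mathbb{C}_+)$ of Dirichlet series absolutely convergent in $\mathbb{C}_+$, and it contains, apart from $0$, a dense vector subspace of $D_a(\mathbb{C}_+)$.
   Context: $\mathbb{C}_+=\{s\in\mathbb{C}:\operatorname{Re} s>0\}$. For a Dirichlet series $D=\sum_{n=1}^\infty a_n n^{-s}$ ($a_n\in\mathbb{C}$), $S_N D=\sum_{n=1}^N a_n n^{-s}$, regarded as an entire function. $D_a(\mathbb{C}_+)$ is the space of Dirichlet series $\sum_{n=1}^{\infty}a_n n^{-s}$ with $\left\|\sum_{n=1}^{\infty}a_n n^{-s}\right\|_\sigma:=\sum_{n=1}^{\infty}|a_n|n^{-\sigma}<\infty$ for all $\sigma>0$, endowed with the Fréchet topology induced by the semi-norms $\|\cdot\|_\sigma$, $\sigma>0$. "Contains, apart from $0$, a dense vector subspace" means that there is a dense vector subspace of $D_a(\mathbb{C}_+)$ all of whose nonzero elements belong to the set. *)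

theory Defs
  imports "HOL-Complex_Analysis.Complex_Analysis" "HOL-Library.Function_Algebras"
begin

text \<open>
  A Dirichlet series \<open>\<Sum>n\<ge>1. a n * n\<^sup>-\<^sup>s\<close> is represented by its coefficient sequence
  \<open>a :: nat \<Rightarrow> complex\<close>. Since there is no coefficient with index \<open>0\<close>, elements of the space
  below satisfy \<open>a 0 = 0\<close>, so that distinct sequences stand for distinct series. The term with
  index \<open>0\<close> also vanishes in the semi-norms, because \<open>0 powr x = 0\<close>.
\<close>

definition dirichlet_seminorm :: "real \<Rightarrow> (nat \<Rightarrow> complex) \<Rightarrow> real" where
  "dirichlet_seminorm \<sigma> a = (\<Sum>n. cmod (a n) * real n powr (-\<sigma>))"

definition abs_conv_dirichlet :: "(nat \<Rightarrow> complex) set" where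
  "abs_conv_dirichlet =
     {a. a 0 = 0 \<and> (\<forall>\<sigma>>0. summable (\<lambda>n. cmod (a n) * real n powr (-\<sigma>)))}"

text \<open>The topology on \<^const>\<open>abs_conv_dirichlet\<close> has the open semi-norm balls as a subbase.
  Addition and subtraction of sequences are pointwise.\<close>

definition abs_conv_dirichlet_topology :: "(nat \<Rightarrow> complex) topology" where
  "abs_conv_dirichlet_topology = topology_generated_by
     {{b \<in> abs_conv_dirichlet. dirichlet_seminorm \<sigma> (b - a) < \<epsilon>} | a \<sigma> \<epsilon>.
        a \<in> abs_conv_dirichlet \<and> \<sigma> > 0 \<and> \<epsilon> > 0}"

definition dirichlet_partial_sum :: "(nat \<Rightarrow> complex) \<Rightarrow> nat \<Rightarrow> complex \<Rightarrow> complex" where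
  "dirichlet_partial_sum a N s = (\<Sum>n=1..N. a n * of_nat n powr (-s))"

definition universal_dirichlet :: "(nat \<Rightarrow> complex) \<Rightarrow> bool" where
  "universal_dirichlet a \<longleftrightarrow>
     (\<forall>g. g holomorphic_on UNIV \<longrightarrow>
       (\<exists>L :: nat \<Rightarrow> nat. (\<forall>n. L n > 0) \<and>
         (\<forall>l K. compact K \<and> K \<subseteq> {s. Re s \<le> 0} \<longrightarrow>
           uniform_limit K (\<lambda>n. (deriv ^^ l) (dirichlet_partial_sum a (L n)))
             ((deriv ^^ l) g) sequentially)))"

definition dirichlet_scale :: "complex \<Rightarrow> (nat \<Rightarrow> complex) \<Rightarrow> nat \<Rightarrow> complex" where
  "dirichlet_scale c a = (\<lambda>n. c * a n)"

lemma vector_space_dirichlet_scale: "vector_space dirichlet_scale"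
  by unfold_locales
    (simp_all add: dirichlet_scale_def plus_fun_def distrib_left distrib_right mult.assoc)

lemma topspace_abs_conv_dirichlet_topology [simp]:
  "topspace abs_conv_dirichlet_topology = abs_conv_dirichlet"
proof (rule equalityI)
  show "topspace abs_conv_dirichlet_topology \<subseteq> abs_conv_dirichlet"
    unfolding abs_conv_dirichlet_topology_def topology_generated_by_topspace
    by (rule Union_least) auto
  show "abs_conv_dirichlet \<subseteq> topspace abs_conv_dirichlet_topology"
    unfolding abs_conv_dirichlet_topology_def topology_generated_by_topspace
  proof
    fix a assume a: "a \<in> abs_conv_dirichlet"
    show "a \<in> \<Union>{{b \<in> abs_conv_dirichlet. dirichlet_seminorm \<sigma> (b - a) < \<epsilon>} | a \<sigma> \<epsilon>.
        a \<in> abs_conv_dirichlet \<and> \<sigma> > 0 \<and> \<epsilon> > 0}"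
    proof (rule UnionI)
      show "a \<in> {b \<in> abs_conv_dirichlet. dirichlet_seminorm 1 (b - a) < 1}"
        using a by (simp add: dirichlet_seminorm_def)
    qed (use a zero_less_one in blast)
  qed
qed

lemma subspace_abs_conv_dirichlet: "module.subspace dirichlet_scale abs_conv_dirichlet"
proof -
  interpret vector_space dirichlet_scale
    by (rule vector_space_dirichlet_scale)
  show ?thesis
  proof (rule subspaceI)
    show "0 \<in> abs_conv_dirichlet"
      by (simp add: abs_conv_dirichlet_def)
  next
    fix a b assume a: "a \<in> abs_conv_dirichlet" and b: "b \<in> abs_conv_dirichlet"
    have "summable (\<lambda>n. cmod ((a + b) n) * real n powr (-\<sigma>))" if "\<sigma> > 0" for \<sigma>
    proof (rule summable_comparison_test')
      show "summable (\<lambda>n. cmod (a n) * real n powr (-\<sigma>) + cmod (b n) * real n powr (-\<sigma>))"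
        using a b that by (simp add: abs_conv_dirichlet_def summable_add)
      show "norm (cmod ((a + b) n) * real n powr (-\<sigma>)) \<le>
          cmod (a n) * real n powr (-\<sigma>) + cmod (b n) * real n powr (-\<sigma>)" for n
        using mult_right_mono[OF norm_triangle_ineq[of "a n" "b n"], of "real n powr (-\<sigma>)"]
        by (simp add: abs_mult distrib_right)
    qed
    then show "a + b \<in> abs_conv_dirichlet"
      using a b by (simp add: abs_conv_dirichlet_def)
  next
    fix c a assume "a \<in> abs_conv_dirichlet"
    then show "dirichlet_scale c a \<in> abs_conv_dirichlet"
      by (simp add: abs_conv_dirichlet_def dirichlet_scale_def norm_mult mult.assoc
          summable_mult)
  qed
qed

end

theory Submission
  imports Defs "HOL-Computational_Algebra.Fundamental_Theorem_Algebra"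
begin

text \<open>
  Everything rests on one approximation result, lemma \<open>dirichlet_block\<close>: beyond any index there
  is a Dirichlet polynomial whose semi-norm \<open>\<sigma>\<close> is as small as desired and which, with finitely
  many derivatives, is as close as desired to a given entire function on a large half disc in
  \<open>Re s \<le> 0\<close>. Appending such blocks to a Dirichlet polynomial steers its partial sums to any target
  without moving it far in the space.

  By Cauchy's estimates it suffices to approximate uniformly on a compact subset of \<open>Re s < \<sigma>\<close>.
  With \<open>u = \<sigma> - s\<close> one has to approximate an entire function on a compact set \<open>K\<close> in \<open>Re u > 0\<close> by
  a sum \<open>\<Sum> b n * n powr u\<close> with small \<open>\<Sum> \<bar>b n\<bar>\<close>. This is done in two steps.

  \<^item> Real frequencies (\<open>exp_sum_approx\<close>). If \<open>T > 0\<close> is small, \<open>z = exp (T * u)\<close> maps \<open>K\<close> into a half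
    plane \<open>Re z \<ge> \<rho>\<close> with \<open>\<rho> > 1\<close>, away from the closed unit disc. Runge's method of pushing poles
    along a vertical line between the two sets gives a polynomial in \<open>z\<close> that is small on a disc of
    radius larger than 1, hence has a small sum of absolute values of its coefficients, and that is
    close to the transported target on the image of \<open>K\<close>.

  \<^item> Integers (\<open>integer_frequency_interpolation\<close>). The power \<open>x powr u\<close> of a large real \<open>x\<close> differs
    by a bounded amount from a bounded combination of the powers of the integers next to \<open>x\<close>:
    interpolate in the base with degree at least \<open>\<bar>u\<bar>\<close>. A bounded error is good enough, because it
    gets multiplied by the small coefficients of the first step.

  Universality amounts to countably many conditions, one for each polynomial with complex rational
  coefficients and each half disc, and each of them is open; so the universal series form a
  \<open>G\<^sub>\<delta>\<close> set. For density no category argument is needed. A construction in stages produces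
  a sequence of series \<open>a m\<close> that follows a dense sequence and such that at each stage all of the
  finitely many series under construction have partial sums of the same length close to \<open>0\<close>, except
  for one, where it is close to a polynomial; every pair of an exceptional index and a polynomial
  occurs at arbitrarily late stages. Hence in a finite combination with \<open>c m \<noteq> 0\<close> these partial sums
  are close to \<open>c m\<close> times the polynomial: the combination is universal. The combinations form the
  dense subspace, and as the space has no isolated points, its nonzero elements are dense too.
\<close>

section \<open>Polynomial approximation on separated compact sets\<close>

text \<open>For compact \<open>S\<close> these functions form the uniform closure of the polynomials, a closed algebra.\<close>

definition poly_approximable :: "complex set \<Rightarrow> (complex \<Rightarrow> complex) \<Rightarrow> bool" where
  "poly_approximable S f \<longleftrightarrow> (\<forall>\<epsilon>>0. \<exists>p. \<forall>z\<in>S. cmod (poly p z - f z) \<le> \<epsilon>)"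

lemma poly_approximableD:
  assumes "poly_approximable S f" "\<epsilon> > 0"
  obtains p where "\<And>z. z \<in> S \<Longrightarrow> cmod (poly p z - f z) \<le> \<epsilon>"
  using assms unfolding poly_approximable_def by blast

lemma poly_approximable_poly: "poly_approximable S (poly p)"
  unfolding poly_approximable_def by (intro allI impI exI[of _ p]) simp

lemma poly_approximable_limit:
  assumes "\<And>\<epsilon>. \<epsilon> > 0 \<Longrightarrow> \<exists>g. poly_approximable S g \<and> (\<forall>z\<in>S. cmod (g z - f z) \<le> \<epsilon>)"
  shows "poly_approximable S f"
  unfolding poly_approximable_def
proof (intro allI impI)
  fix \<epsilon> :: real assume "\<epsilon> > 0"
  then obtain g where g: "poly_approximable S g" "\<forall>z\<in>S. cmod (g z - f z) \<le> \<epsilon>/2"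
    using assms[of "\<epsilon>/2"] by auto
  obtain p where p: "\<And>z. z \<in> S \<Longrightarrow> cmod (poly p z - g z) \<le> \<epsilon>/2"
    using poly_approximableD[OF g(1), of "\<epsilon>/2"] \<open>\<epsilon> > 0\<close> by auto
  have "cmod (poly p z - f z) \<le> \<epsilon>" if "z \<in> S" for z
    using norm_triangle_ineq[of "poly p z - g z" "g z - f z"] p[OF that] g(2) that by fastforce
  then show "\<exists>p. \<forall>z\<in>S. cmod (poly p z - f z) \<le> \<epsilon>" by blast
qed

lemma poly_approximable_add:
  assumes "poly_approximable S f" "poly_approximable S g"
  shows "poly_approximable S (\<lambda>z. f z + g z)"
  unfolding poly_approximable_def
proof (intro allI impI)
  fix \<epsilon> :: real assume "\<epsilon> > 0"
  then have e: "\<epsilon>/2 > 0" by simp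
  obtain p where p: "\<And>z. z \<in> S \<Longrightarrow> cmod (poly p z - f z) \<le> \<epsilon>/2"
    using poly_approximableD[OF assms(1) e] by blast
  obtain q where q: "\<And>z. z \<in> S \<Longrightarrow> cmod (poly q z - g z) \<le> \<epsilon>/2"
    using poly_approximableD[OF assms(2) e] by blast
  have "cmod (poly (p + q) z - (f z + g z)) \<le> \<epsilon>" if "z \<in> S" for z
    using norm_triangle_ineq[of "poly p z - f z" "poly q z - g z"] p[OF that] q[OF that]
    by (simp add: algebra_simps)
  then show "\<exists>p. \<forall>z\<in>S. cmod (poly p z - (f z + g z)) \<le> \<epsilon>" by blast
qed

lemma poly_approximable_bounded:
  assumes "compact S" "poly_approximable S f"
  obtains B where "B > 0" "\<And>z. z \<in> S \<Longrightarrow> cmod (f z) \<le> B"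
proof -
  obtain p where p: "\<And>z. z \<in> S \<Longrightarrow> cmod (poly p z - f z) \<le> 1"
    using poly_approximableD[OF assms(2), of 1] by auto
  have "bounded (poly p ` S)"
    by (intro compact_imp_bounded compact_continuous_image assms continuous_intros)
  then obtain B where B: "B > 0" "\<And>z. z \<in> S \<Longrightarrow> cmod (poly p z) \<le> B"
    unfolding bounded_pos by auto
  show ?thesis
  proof (rule that[of "B + 1"])
    show "cmod (f z) \<le> B + 1" if "z \<in> S" for z
      using norm_triangle_ineq4[of "poly p z" "poly p z - f z"] p[OF that] B(2)[OF that] by simp
  qed (use B in simp)
qed

lemma poly_approximable_mult:
  assumes S: "compact S" and f: "poly_approximable S f" and g: "poly_approximable S g"
  shows "poly_approximable S (\<lambda>z. f z * g z)"
  unfolding poly_approximable_def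
proof (intro allI impI)
  fix \<epsilon> :: real assume \<epsilon>: "\<epsilon> > 0"
  obtain B where B: "B > 0" "\<And>z. z \<in> S \<Longrightarrow> cmod (f z) \<le> B"
    using poly_approximable_bounded[OF S f] by blast
  obtain q where q: "\<And>z. z \<in> S \<Longrightarrow> cmod (poly q z - g z) \<le> \<epsilon> / (2 * B)"
    using poly_approximableD[OF g, of "\<epsilon> / (2 * B)"] B(1) \<epsilon> by auto
  obtain C where C: "C > 0" "\<And>z. z \<in> S \<Longrightarrow> cmod (poly q z) \<le> C"
    using poly_approximable_bounded[OF S poly_approximable_poly] by blast
  obtain p where p: "\<And>z. z \<in> S \<Longrightarrow> cmod (poly p z - f z) \<le> \<epsilon> / (2 * C)"
    using poly_approximableD[OF f, of "\<epsilon> / (2 * C)"] C(1) \<epsilon> by auto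
  have "cmod (poly (p * q) z - f z * g z) \<le> \<epsilon>" if z: "z \<in> S" for z
  proof -
    have "poly (p * q) z - f z * g z = (poly p z - f z) * poly q z + f z * (poly q z - g z)"
      by (simp add: algebra_simps)
    then have "cmod (poly (p * q) z - f z * g z)
        \<le> cmod (poly p z - f z) * cmod (poly q z) + cmod (f z) * cmod (poly q z - g z)"
      by (metis norm_mult norm_triangle_ineq)
    also have "\<dots> \<le> \<epsilon> / (2 * C) * C + B * (\<epsilon> / (2 * B))"
      by (intro add_mono mult_mono p[OF z] q[OF z] B(2)[OF z] C(2)[OF z])
        (use \<epsilon> B C in auto)
    also have "\<dots> = \<epsilon>" using B C by (simp add: field_simps)
    finally show ?thesis .
  qed
  then show "\<exists>p. \<forall>z\<in>S. cmod (poly p z - f z * g z) \<le> \<epsilon>" by blast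
qed

lemma poly_approximable_const: "poly_approximable S (\<lambda>_. c)"
  using poly_approximable_poly[of S "[:c:]"] by (simp add: poly_approximable_def)

lemma poly_approximable_power:
  "compact S \<Longrightarrow> poly_approximable S f \<Longrightarrow> poly_approximable S (\<lambda>z. f z ^ n)"
  by (induction n) (auto intro: poly_approximable_const poly_approximable_mult)

lemma poly_approximable_sum:
  "finite A \<Longrightarrow> (\<And>i. i \<in> A \<Longrightarrow> poly_approximable S (f i))
    \<Longrightarrow> poly_approximable S (\<lambda>z. \<Sum>i\<in>A. f i z)"
  by (induction rule: finite_induct) (auto intro: poly_approximable_const poly_approximable_add)

lemma poly_approximable_prod:
  "finite A \<Longrightarrow> compact S \<Longrightarrow> (\<And>i. i \<in> A \<Longrightarrow> poly_approximable S (f i))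
    \<Longrightarrow> poly_approximable S (\<lambda>z. \<Prod>i\<in>A. f i z)"
  by (induction rule: finite_induct) (auto intro: poly_approximable_const poly_approximable_mult)

text \<open>The Neumann series \<open>\<Sum>k. h ^ k / f ^ Suc k\<close> of \<open>1 / (f - h)\<close> converges uniformly, because
  \<open>\<bar>h / f\<bar> \<le> \<theta> < 1\<close>. This serves both to expand \<open>1 / (z - p)\<close> in powers of \<open>z\<close> for a distant \<open>p\<close>
  and to move the pole \<open>p\<close>.\<close>

lemma poly_approximable_inverse_near:
  assumes S: "compact S" and f: "poly_approximable S (\<lambda>z. inverse (f z))"
    and d: "d > 0" and sep: "\<And>z. z \<in> S \<Longrightarrow> d \<le> cmod (f z)" and \<theta>: "\<theta> < 1"
    and h: "poly_approximable S h" and close: "\<And>z. z \<in> S \<Longrightarrow> cmod (h z) \<le> \<theta> * cmod (f z)"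
  shows "poly_approximable S (\<lambda>z. inverse (f z - h z))"
proof (cases "S = {}")
  case False
  have \<theta>0: "\<theta> \<ge> 0"
  proof -
    obtain z where "z \<in> S" using False by auto
    have "0 \<le> \<theta> * cmod (f z)" using close[OF \<open>z \<in> S\<close>] norm_ge_zero order_trans by blast
    moreover have "0 < cmod (f z)" using sep[OF \<open>z \<in> S\<close>] d by linarith
    ultimately show ?thesis by (simp add: zero_le_mult_iff)
  qed
  show ?thesis
  proof (rule poly_approximable_limit)
    fix \<epsilon> :: real assume \<epsilon>: "\<epsilon> > 0"
    have "(\<lambda>n. \<theta> ^ n) \<longlonglongrightarrow> 0" using \<theta> \<theta>0 by (intro LIMSEQ_power_zero) auto
    moreover have "\<epsilon> * ((1 - \<theta>) * d) > 0" using \<epsilon> \<theta> d by simp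
    ultimately obtain n where n: "\<theta> ^ n < \<epsilon> * ((1 - \<theta>) * d)"
      by (metis eventually_sequentially order_refl order_tendstoD(2))
    define g where "g = (\<lambda>z. inverse (f z) * (\<Sum>k<n. (h z * inverse (f z)) ^ k))"
    have "cmod (g z - inverse (f z - h z)) \<le> \<epsilon>" if z: "z \<in> S" for z
    proof -
      define w where "w = h z * inverse (f z)"
      have f0: "f z \<noteq> 0" using sep[OF z] d by auto
      have w: "cmod w \<le> \<theta>"
        using close[OF z] f0 unfolding w_def divide_inverse[symmetric]
        by (simp add: norm_divide pos_divide_le_eq)
      then have w1: "w \<noteq> 1" using \<theta> by auto
      have lower: "1 - \<theta> \<le> cmod (1 - w)"
        using norm_triangle_ineq2[of 1 w] w by simp
      have "f z - h z = f z * (1 - w)" using f0 by (simp add: w_def algebra_simps)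
      then have "inverse (f z - h z) = inverse (f z) * (1 / (1 - w))"
        by (simp add: divide_inverse)
      moreover have "g z = inverse (f z) * ((1 - w ^ n) / (1 - w))"
        unfolding g_def w_def[symmetric] using w1 by (simp add: sum_gp_strict)
      ultimately have "g z - inverse (f z - h z) = inverse (f z) * ((1 - w ^ n) / (1 - w) - 1 / (1 - w))"
        by (simp only: right_diff_distrib)
      also have "(1 - w ^ n) / (1 - w) - 1 / (1 - w) = - (w ^ n / (1 - w))"
        by (simp add: diff_divide_distrib[symmetric])
      finally have "g z - inverse (f z - h z) = - inverse (f z) * (w ^ n / (1 - w))" by simp
      then have "cmod (g z - inverse (f z - h z)) = cmod w ^ n / (cmod (f z) * cmod (1 - w))"
        by (simp only: norm_mult norm_divide norm_inverse norm_power norm_minus_cancel)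
          (simp add: divide_inverse)
      also have "\<dots> \<le> \<theta> ^ n / (d * (1 - \<theta>))"
        by (intro frac_le power_mono mult_mono w sep[OF z] lower) (use \<theta>0 \<theta> d in auto)
      also have "\<dots> \<le> \<epsilon>" using n d \<theta> by (simp add: field_simps)
      finally show ?thesis .
    qed
    moreover have "poly_approximable S g"
      unfolding g_def
      by (intro poly_approximable_mult poly_approximable_sum poly_approximable_power S f h) auto
    ultimately show "\<exists>g. poly_approximable S g \<and> (\<forall>z\<in>S. cmod (g z - inverse (f z - h z)) \<le> \<epsilon>)"
      by blast
  qed
qed (simp add: poly_approximable_def)

text \<open>Runge's pole pushing. The pole walks along the line \<open>Re z = c\<close>, on which its distance to \<open>S\<close> has
  a positive lower bound \<open>d\<close>, from a point so far away that the geometric series in \<open>z\<close> applies.\<close>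

lemma poly_approximable_inverse_line:
  assumes S: "compact S" and off: "\<And>z. z \<in> S \<Longrightarrow> Re z \<noteq> c" and p: "Re p = c"
  shows "poly_approximable S (\<lambda>z. inverse (z - p))"
proof -
  have "closed {z. Re z = c}" by (simp add: closed_halfspace_Re_eq)
  then obtain d where d: "d > 0" and "\<forall>x\<in>S. \<forall>y\<in>{z. Re z = c}. d \<le> dist x y"
    using separate_compact_closed[OF S, of "{z. Re z = c}"] off by auto
  then have sep: "d \<le> cmod (z - q)" if "z \<in> S" "Re q = c" for z q
    using that by (simp add: dist_norm)
  obtain B where B: "B > 0" "\<And>z. z \<in> S \<Longrightarrow> cmod z \<le> B"
    using compact_imp_bounded[OF S] unfolding bounded_pos by auto
  define q where "q k = p + \<i> * of_real (real k * (d/2))" for k :: nat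
  have Re_q: "Re (q k) = c" for k by (simp add: q_def p)
  \<comment> \<open>A step of length \<open>d/2\<close> along the line keeps approximability; far away it is plain.\<close>
  have step: "poly_approximable S (\<lambda>z. inverse (z - q k))"
    if "poly_approximable S (\<lambda>z. inverse (z - q (Suc k)))" for k
  proof -
    have "poly_approximable S (\<lambda>z. inverse ((z - q (Suc k)) - (- \<i> * of_real (d/2))))"
    proof (rule poly_approximable_inverse_near[OF S that d, where \<theta> = "1/2"])
      show "d \<le> cmod (z - q (Suc k))" if "z \<in> S" for z using sep[OF that Re_q] .
      show "cmod (- \<i> * of_real (d/2)) \<le> 1/2 * cmod (z - q (Suc k))" if "z \<in> S" for z
        using sep[OF that Re_q, of "Suc k"] d by (simp add: norm_mult)
    qed (auto intro: poly_approximable_const)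
    moreover have "(\<lambda>z. inverse ((z - q (Suc k)) - (- \<i> * of_real (d/2)))) = (\<lambda>z. inverse (z - q k))"
      by (simp add: q_def algebra_simps add_divide_distrib)
    ultimately show ?thesis by simp
  qed
  obtain n :: nat where n: "real n * (d/2) > 2 * B + cmod p"
    using reals_Archimedean3[of "d/2"] d by (metis half_gt_zero_iff)
  have far: "2 * B < cmod (q n)"
  proof -
    have "real n * (d/2) = cmod (q n - p)" using d by (simp add: q_def norm_mult)
    also have "\<dots> \<le> cmod (q n) + cmod p" by (rule norm_triangle_ineq4)
    finally show ?thesis using n by simp
  qed
  have "poly_approximable S (\<lambda>z. inverse (- q n - (- z)))"
  proof (rule poly_approximable_inverse_near[OF S _, where \<theta> = "1/2" and d = B])
    show "poly_approximable S uminus"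
      using poly_approximable_poly[of S "[:0, -1:]"] by (simp add: poly_approximable_def)
    show "cmod (- z) \<le> 1 / 2 * cmod (- q n)" if "z \<in> S" for z
      using far B(2)[OF that] by simp
  qed (use far B(1) in \<open>auto intro: poly_approximable_const\<close>)
  then have base: "poly_approximable S (\<lambda>z. inverse (z - q n))" by simp
  have "poly_approximable S (\<lambda>z. inverse (z - q (n - k)))" if "k \<le> n" for k
    using that
  proof (induction k)
    case (Suc k)
    then show ?case using step[of "n - Suc k"] by (simp add: Suc_diff_Suc)
  qed (use base in simp)
  from this[of n] show ?thesis by (simp add: q_def)
qed

lemma poly_approximable_inverse_poly:
  assumes S: "compact S" and P: "P \<noteq> 0" and off: "\<And>z. z \<in> S \<Longrightarrow> Re z \<noteq> c"
    and roots: "\<And>z. poly P z = 0 \<Longrightarrow> Re z = c"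
  shows "poly_approximable S (\<lambda>z. inverse (poly P z))"
proof -
  obtain root where P_eq: "smult (lead_coeff P) (\<Prod>i<degree P. [:- root i, 1:]) = P"
    using complex_poly_decompose' .
  have eval: "poly P z = lead_coeff P * (\<Prod>i<degree P. z - root i)" for z
    by (subst P_eq[symmetric]) (simp add: poly_prod)
  have "Re (root i) = c" if "i < degree P" for i
    using that by (intro roots) (auto simp: eval)
  then have "poly_approximable S
      (\<lambda>z. inverse (lead_coeff P) * (\<Prod>i<degree P. inverse (z - root i)))"
    by (intro poly_approximable_mult poly_approximable_prod poly_approximable_const S
        poly_approximable_inverse_line[OF S off]) auto
  then show ?thesis
    by (simp add: eval prod_inversef[symmetric] o_def)
qed

text \<open>With \<open>w = (z - a) / (z - b)\<close> for two points symmetric to the line \<open>Re z = c\<close>, one has \<open>\<bar>w\<bar> < 1\<close> on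
  the left and \<open>\<bar>w\<bar> > 1\<close> on the right. So \<open>w ^ n / (w ^ n - 1)\<close> tends to \<open>0\<close> on \<open>S\<close> and to \<open>1\<close> on \<open>T\<close>,
  and its poles, at which \<open>\<bar>w\<bar> = 1\<close>, lie on the line.\<close>

lemma poly_separating_halfplanes:
  assumes S: "compact S" and T: "compact T" and \<epsilon>: "\<epsilon> > 0"
    and left: "\<And>z. z \<in> S \<Longrightarrow> Re z < c" and right: "\<And>z. z \<in> T \<Longrightarrow> Re z > c"
  obtains p where "\<And>z. z \<in> S \<Longrightarrow> cmod (poly p z) \<le> \<epsilon>"
    and "\<And>z. z \<in> T \<Longrightarrow> cmod (poly p z - 1) \<le> \<epsilon>"
proof -
  define a where "a = complex_of_real (c - 1)"
  define b where "b = complex_of_real (c + 1)"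
  have sq: "cmod (z - a)^2 = cmod (z - b)^2 + 4 * (Re z - c)" for z
    unfolding cmod_power2 by (simp add: a_def b_def power2_eq_square algebra_simps)
  have lt_iff: "cmod (z - a) < cmod (z - b) \<longleftrightarrow> Re z < c" for z
    using sq[of z] by (smt (verit) norm_ge_zero power2_le_imp_le power_strict_mono zero_less_numeral)
  have gt_iff: "cmod (z - b) < cmod (z - a) \<longleftrightarrow> Re z > c" for z
    using sq[of z] by (smt (verit) norm_ge_zero power2_le_imp_le power_strict_mono zero_less_numeral)
  have za: "z \<noteq> a" if "Re z > c" for z using that by (auto simp: a_def)
  have zb: "z \<noteq> b" if "Re z < c" for z using that by (auto simp: b_def)
  have bound: "\<exists>\<theta>. 0 \<le> \<theta> \<and> \<theta> < 1 \<and> (\<forall>z\<in>X. f z \<le> \<theta>)"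
    if "compact X" "continuous_on X f" "\<And>z. z \<in> X \<Longrightarrow> f z < 1" "\<And>z. z \<in> X \<Longrightarrow> 0 \<le> f z"
    for X :: "complex set" and f :: "complex \<Rightarrow> real"
  proof (cases "X = {}")
    case False
    then show ?thesis using continuous_attains_sup[OF that(1) _ that(2)] that(3,4) by blast
  qed (auto intro!: exI[of _ 0])
  obtain \<theta> where \<theta>: "0 \<le> \<theta>" "\<theta> < 1" "\<And>z. z \<in> S \<Longrightarrow> cmod (z - a) / cmod (z - b) \<le> \<theta>"
  proof -
    have "continuous_on S (\<lambda>z. cmod (z - a) / cmod (z - b))"
      using left zb by (intro continuous_intros) auto
    then show ?thesis
      using bound[OF S, of "\<lambda>z. cmod (z - a) / cmod (z - b)"] left zb lt_iff that
      by (force simp: divide_less_eq)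
  qed
  obtain \<eta> where \<eta>: "0 \<le> \<eta>" "\<eta> < 1" "\<And>z. z \<in> T \<Longrightarrow> cmod (z - b) / cmod (z - a) \<le> \<eta>"
  proof -
    have "continuous_on T (\<lambda>z. cmod (z - b) / cmod (z - a))"
      using right za by (intro continuous_intros) auto
    then show ?thesis
      using bound[OF T, of "\<lambda>z. cmod (z - b) / cmod (z - a)"] right za gt_iff that
      by (force simp: divide_less_eq)
  qed
  define \<kappa> where "\<kappa> = max \<theta> \<eta>"
  have \<kappa>: "0 \<le> \<kappa>" "\<kappa> < 1" using \<theta> \<eta> by (auto simp: \<kappa>_def)
  define e where "e = min (1/2) (\<epsilon>/4)"
  have e: "0 < e" "e \<le> 1/2" "e \<le> \<epsilon>/4" using \<epsilon> by (auto simp: e_def)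
  have "(\<lambda>n. \<kappa> ^ n) \<longlonglongrightarrow> 0" using \<kappa> by (intro LIMSEQ_power_zero) auto
  then have "\<forall>\<^sub>F n in sequentially. \<kappa> ^ n < e" by (rule order_tendstoD) (rule e)
  then obtain n where n: "\<kappa> ^ n < e" unfolding eventually_sequentially by blast
  have n0: "n \<noteq> 0" using n e by (intro notI) simp
  \<comment> \<open>Multiplied out, \<open>w ^ n / (w ^ n - 1)\<close> is \<open>(z - a) ^ n / P z\<close>.\<close>
  define P where "P = [:-a, 1:] ^ n - [:-b, 1:] ^ n"
  have P: "poly P z = (z - a) ^ n - (z - b) ^ n" for z by (simp add: P_def)
  define \<phi> where "\<phi> z = (z - a) ^ n * inverse (poly P z)" for z
  have "poly P a \<noteq> 0" using n0 by (simp add: P a_def b_def power_0_left)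
  then have "P \<noteq> 0" by auto
  have "Re z = c" if "poly P z = 0" for z
  proof -
    have "cmod (z - a) ^ n = cmod (z - b) ^ n"
      using that by (metis P eq_iff_diff_eq_0 norm_power)
    then have "cmod (z - a) = cmod (z - b)" using n0 by (simp add: power_eq_iff_eq_base)
    then show ?thesis using lt_iff[of z] gt_iff[of z] by linarith
  qed
  then have inv: "poly_approximable (S \<union> T) (\<lambda>z. inverse (poly P z))"
    using left right
    by (intro poly_approximable_inverse_poly[of _ _ c] compact_Un S T \<open>P \<noteq> 0\<close>) force+
  have "poly_approximable (S \<union> T) (\<lambda>z. poly [:-a, 1:] z ^ n)"
    by (intro poly_approximable_power poly_approximable_poly compact_Un S T)
  then have "poly_approximable (S \<union> T) \<phi>"
    unfolding \<phi>_def using inv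
    by (intro poly_approximable_mult compact_Un S T) auto
  then obtain p where p: "\<And>z. z \<in> S \<union> T \<Longrightarrow> cmod (poly p z - \<phi> z) \<le> \<epsilon>/2"
    using poly_approximableD[of "S \<union> T" \<phi> "\<epsilon>/2"] \<epsilon> by auto
  have ratio: "cmod (w / (1 - w)) \<le> \<epsilon>/2" if "cmod w \<le> \<kappa> ^ n" for w
  proof -
    have w: "cmod w \<le> e" using that n by simp
    then have "1/2 \<le> cmod (1 - w)" using norm_triangle_ineq2[of 1 w] e by simp
    then have "cmod w / cmod (1 - w) \<le> e / (1/2)"
      using w e by (intro frac_le) auto
    also have "e / (1/2) \<le> \<epsilon>/2" using e by simp
    finally show ?thesis by (simp add: norm_divide)
  qed
  show ?thesis
  proof (rule that[of p])
    fix z assume z: "z \<in> S"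
    define w where "w = ((z - a) / (z - b)) ^ n"
    have nz: "z \<noteq> b" using zb left z by blast
    have "cmod w \<le> \<kappa> ^ n"
      unfolding w_def norm_power norm_divide using \<theta>(3)[OF z]
      by (intro power_mono) (auto simp: \<kappa>_def)
    moreover have "\<phi> z = - (w / (1 - w))"
    proof -
      have "w * (z - b) ^ n = (z - a) ^ n" using nz by (simp add: w_def power_divide)
      then have "poly P z = (w - 1) * (z - b) ^ n" "(z - a) ^ n = w * (z - b) ^ n"
        by (simp_all add: P algebra_simps)
      then show ?thesis
        unfolding \<phi>_def using nz by (simp add: divide_simps) (auto simp: algebra_simps)
    qed
    ultimately have "cmod (\<phi> z) \<le> \<epsilon>/2" using ratio by simp
    then show "cmod (poly p z) \<le> \<epsilon>"
      using p[of z] z norm_triangle_ineq[of "poly p z - \<phi> z" "\<phi> z"] by simp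
  next
    fix z assume z: "z \<in> T"
    define w where "w = ((z - b) / (z - a)) ^ n"
    have nz: "z \<noteq> a" using za right z by blast
    have w: "cmod w \<le> \<kappa> ^ n"
      unfolding w_def norm_power norm_divide using \<eta>(3)[OF z]
      by (intro power_mono) (auto simp: \<kappa>_def)
    then have "w \<noteq> 1" using n e by auto
    moreover have "w * (z - a) ^ n = (z - b) ^ n" using nz by (simp add: w_def power_divide)
    then have "poly P z = (1 - w) * (z - a) ^ n" by (simp add: P algebra_simps)
    ultimately have "\<phi> z - 1 = w / (1 - w)"
      unfolding \<phi>_def using nz by (simp add: divide_simps)
    then have "cmod (\<phi> z - 1) \<le> \<epsilon>/2" using ratio[OF w] by simp
    then show "cmod (poly p z - 1) \<le> \<epsilon>"
      using p[of z] z norm_triangle_ineq[of "poly p z - \<phi> z" "\<phi> z - 1"] by simp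
  qed
qed

section \<open>Exponential sums with small coefficients\<close>

lemma holomorphic_poly_approx:
  assumes f: "f holomorphic_on ball X R" and r: "r < R" and \<epsilon>: "\<epsilon> > 0"
  obtains p where "\<And>z. z \<in> cball X r \<Longrightarrow> cmod (poly p z - f z) \<le> \<epsilon>"
proof -
  define a where "a n = (deriv ^^ n) f X / fact n" for n
  have sums: "(\<lambda>n. a n * (z - X) ^ n) sums f z" if "z \<in> ball X R" for z
    unfolding a_def using holomorphic_power_series[OF f that] .
  have "conv_radius a \<ge> R"
  proof (rule conv_radius_geI_ex')
    fix t :: real assume t: "0 < t" "ereal t < ereal R"
    have "(\<lambda>n. a n * ((X + of_real t) - X) ^ n) sums f (X + of_real t)"
      using t by (intro sums) (simp add: dist_norm)
    then show "summable (\<lambda>n. a n * of_real t ^ n)" by (simp add: sums_iff)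
  qed
  then have "ereal r < conv_radius a" using r by (meson less_ereal.simps(1) less_le_trans)
  from powser_uniform_limit[OF this, of X]
  have "uniform_limit (cball X r) (\<lambda>n z. \<Sum>i<n. a i * (z - X) ^ i)
      (\<lambda>z. suminf (\<lambda>i. a i * (z - X) ^ i)) sequentially" .
  from uniform_limitD[OF this \<epsilon>] obtain n where
    n: "\<And>z. z \<in> cball X r \<Longrightarrow>
      dist (\<Sum>i<n. a i * (z - X) ^ i) (suminf (\<lambda>i. a i * (z - X) ^ i)) < \<epsilon>"
    unfolding eventually_sequentially by blast
  show ?thesis
  proof (rule that[of "\<Sum>i<n. smult (a i) ([:-X, 1:] ^ i)"])
    fix z assume z: "z \<in> cball X r"
    then have "suminf (\<lambda>i. a i * (z - X) ^ i) = f z"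
      using sums[of z] r by (simp add: sums_iff)
    moreover have "poly (\<Sum>i<n. smult (a i) ([:-X, 1:] ^ i)) z = (\<Sum>i<n. a i * (z - X) ^ i)"
      by (simp add: poly_sum)
    ultimately show "cmod (poly (\<Sum>i<n. smult (a i) ([:-X, 1:] ^ i)) z - f z) \<le> \<epsilon>"
      using n[OF z] by (simp add: dist_norm)
  qed
qed

lemma higher_deriv_poly: "(deriv ^^ n) (poly p) = poly ((pderiv ^^ n) p)" for p :: "complex poly"
proof (induction n)
  case (Suc n)
  have "deriv (poly q) = poly (pderiv q)" for q :: "complex poly"
    by (rule ext) (rule DERIV_imp_deriv, rule poly_DERIV)
  with Suc show ?case by simp
qed simp

lemma poly_coeff_Cauchy:
  assumes r: "r > 0" and B: "\<And>z. cmod z \<le> r \<Longrightarrow> cmod (poly p z) \<le> B"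
  shows "cmod (coeff p k) \<le> B / r ^ k"
proof -
  have "cmod ((deriv ^^ k) (poly p) 0) \<le> fact k * B / r ^ k"
    using B r by (intro Cauchy_inequality) (auto intro!: holomorphic_intros continuous_intros)
  moreover have "(deriv ^^ k) (poly p) 0 = fact k * coeff p k"
    by (simp add: higher_deriv_poly poly_0_coeff_0 coeff_higher_pderiv pochhammer_fact)
  ultimately have "fact k * cmod (coeff p k) \<le> fact k * (B / r ^ k)"
    by (simp add: norm_mult)
  then show ?thesis by (simp only: mult_le_cancel_left_pos[OF fact_gt_zero])
qed

text \<open>This is the link between the supremum on a disc and the norm of absolutely convergent series:
  the radius must exceed \<open>1\<close> for the Cauchy bounds to be summable.\<close>

lemma poly_coeff_sum_le:
  assumes r: "r > 1" and B: "\<And>z. cmod z \<le> r \<Longrightarrow> cmod (poly p z) \<le> B"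
  shows "(\<Sum>k\<le>n. cmod (coeff p k)) \<le> B * (r / (r - 1))"
proof -
  have B0: "B \<ge> 0" using order_trans[OF norm_ge_zero B[of 0]] r by simp
  have geo: "(\<lambda>k. (1 / r) ^ k) sums (1 / (1 - 1 / r))"
    using r by (intro geometric_sums) simp
  have "(\<Sum>k\<le>n. cmod (coeff p k)) \<le> (\<Sum>k\<le>n. B * (1 / r) ^ k)"
  proof (rule sum_mono)
    fix k
    show "cmod (coeff p k) \<le> B * (1 / r) ^ k"
      using poly_coeff_Cauchy[of r p B k] B r by (simp add: power_divide)
  qed
  also have "\<dots> = B * (\<Sum>k\<le>n. (1 / r) ^ k)" by (simp add: sum_distrib_left)
  also have "\<dots> \<le> B * (1 / (1 - 1 / r))"
  proof (rule mult_left_mono[OF _ B0])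
    have "summable (\<lambda>k. (1 / r) ^ k)" using geo by (rule sums_summable)
    then have "(\<Sum>k\<le>n. (1 / r) ^ k) \<le> (\<Sum>k. (1 / r) ^ k)"
      using r by (intro sum_le_suminf) auto
    then show "(\<Sum>k\<le>n. (1 / r) ^ k) \<le> 1 / (1 - 1 / r)" using sums_unique[OF geo] by simp
  qed
  also have "1 / (1 - 1 / r) = r / (r - 1)" using r by (simp add: field_simps)
  finally show ?thesis .
qed

text \<open>For small \<open>T\<close> the gain \<open>exp (\<delta> * T) \<ge> 1 + \<delta> * T\<close> is of first order, while the loss
  \<open>cos (R * T) \<ge> 1 - (R * T)\<^sup>2 / 2\<close> is of second order.\<close>

lemma exp_sector_step:
  assumes "0 < \<delta>" "\<delta> \<le> R" "1 \<le> R"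
  obtains T :: real where "T > 0" "R * T \<le> 1 / 2" "exp (\<delta> * T) * cos (R * T) > 1"
proof (rule that[of "\<delta> / (2 * R\<^sup>2)"])
  define T where "T = \<delta> / (2 * R\<^sup>2)"
  have R0: "R > 0" using assms by simp
  show "\<delta> / (2 * R\<^sup>2) > 0" using assms by simp
  have RT: "R * T = \<delta> / (2 * R)" using R0 by (simp add: T_def power2_eq_square)
  then show RT_le: "R * (\<delta> / (2 * R\<^sup>2)) \<le> 1 / 2"
    using assms R0 by (simp add: T_def[symmetric] divide_le_eq)
  \<comment> \<open>In terms of \<open>x\<close>, the gain is \<open>\<delta> * T = 2 * x\<close> and the loss is \<open>x / 2\<close>.\<close>
  define x where "x = (R * T)\<^sup>2"
  have RT_pos: "0 < R * T" using assms R0 by (simp add: RT)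
  have "R * T \<le> 1/2" using RT_le by (simp only: T_def)
  then have x: "0 < x" "x \<le> 1/4"
    using RT_pos power_mono[of "R * T" "1/2" 2] by (auto simp: x_def power_divide)
  have \<delta>T: "\<delta> * T = 2 * x"
    using R0 by (simp add: x_def T_def power2_eq_square field_simps)
  have "cos (R * T) \<ge> 1 - x / 2"
    using cos_double_sin[of "R * T / 2"] abs_sin_x_le_abs_x[of "R * T / 2"]
      power_mono[of "\<bar>sin (R * T / 2)\<bar>" "\<bar>R * T / 2\<bar>" 2]
    by (simp add: x_def power2_eq_square)
  moreover have "exp (\<delta> * T) \<ge> 1 + 2 * x" using exp_ge_add_one_self[of "\<delta> * T"] \<delta>T by simp
  ultimately have "exp (\<delta> * T) * cos (R * T) \<ge> (1 + 2 * x) * (1 - x / 2)"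
    using x by (intro mult_mono) auto
  moreover have "(1 + 2 * x) * (1 - x / 2) > 1"
  proof -
    have "(1 + 2 * x) * (1 - x / 2) - 1 = x * (3/2 - x)" by (simp add: field_simps)
    also have "\<dots> > 0" using x by simp
    finally show ?thesis by simp
  qed
  ultimately show "exp (\<delta> * (\<delta> / (2 * R\<^sup>2))) * cos (R * (\<delta> / (2 * R\<^sup>2))) > 1"
    by (simp add: T_def)
qed

text \<open>In the variable \<open>z = exp (T * u)\<close> the sum is a polynomial. It is the product \<open>P * Q\<close>, where \<open>P\<close>
  approximates the target on the image \<open>K'\<close> of \<open>K\<close>, and \<open>Q\<close> is close to \<open>1\<close> on \<open>K'\<close> and so small
  on a disc of radius \<open>r1 > 1\<close> that it suppresses \<open>P\<close> there.\<close>

lemma exp_sum_approx: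
  assumes K: "compact K" and pos: "\<And>u. u \<in> K \<Longrightarrow> Re u > 0" and g: "g holomorphic_on UNIV"
    and \<epsilon>: "\<epsilon> > 0"
  obtains T :: real and d :: nat and q :: "nat \<Rightarrow> complex" where "T > 0"
    and "\<forall>u\<in>K. cmod ((\<Sum>k\<le>d. q k * exp (of_real (real k * T) * u)) - g u) \<le> \<epsilon>"
    and "(\<Sum>k\<le>d. cmod (q k)) \<le> \<epsilon>"
proof -
  obtain \<delta> where \<delta>: "\<delta> > 0" "\<And>u. u \<in> K \<Longrightarrow> \<delta> \<le> Re u"
  proof (cases "K = {}")
    case False
    have "continuous_on K Re" by (intro continuous_intros)
    from continuous_attains_inf[OF K False this] show ?thesis using that pos by blast
  qed (use that[of 1] in auto)
  obtain R0 where R0: "\<And>u. u \<in> K \<Longrightarrow> cmod u \<le> R0"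
    using compact_imp_bounded[OF K] unfolding bounded_iff by blast
  define R where "R = max 1 (max \<delta> R0)"
  have R: "\<delta> \<le> R" "1 \<le> R" "\<And>u. u \<in> K \<Longrightarrow> cmod u \<le> R"
    using R0 by (auto simp: R_def le_max_iff_disj)
  obtain T where T: "T > 0" "R * T \<le> 1 / 2" "exp (\<delta> * T) * cos (R * T) > 1"
    using exp_sector_step[OF \<delta>(1) R(1,2)] .
  define \<rho> where "\<rho> = exp (\<delta> * T) * cos (R * T)"
  define E where "E u = exp (of_real T * u)" for u :: complex
  have Im_E: "\<bar>T * Im u\<bar> \<le> R * T" if "u \<in> K" for u
    using abs_Im_le_cmod[of u] R(3)[OF that] T(1)
    by (simp add: abs_mult mult.commute mult_left_mono)
  have Ln_E: "Ln (E u) = of_real T * u" if "u \<in> K" for u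
    unfolding E_def using Im_E[OF that] T(2) pi_gt3 by (intro Ln_exp) auto
  have Re_E: "\<rho> \<le> Re (E u)" if u: "u \<in> K" for u
  proof -
    have "cos (R * T) \<le> cos \<bar>T * Im u\<bar>"
      using Im_E[OF u] T(2) pi_gt3 by (intro cos_monotone_0_pi_le) auto
    then have "cos (R * T) \<le> cos (T * Im u)" by simp
    moreover have "exp (\<delta> * T) \<le> exp (T * Re u)" using \<delta>(2)[OF u] T(1) by (simp add: mult.commute)
    moreover have "0 \<le> cos (R * T)"
      using T R pi_gt3 by (intro cos_ge_zero) (auto intro: order_trans[of _ 0])
    ultimately have "\<rho> \<le> exp (T * Re u) * cos (T * Im u)"
      unfolding \<rho>_def by (intro mult_mono) auto
    then show ?thesis by (simp add: E_def Re_exp)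
  qed
  define K' where "K' = E ` K"
  have K': "compact K'"
    unfolding K'_def E_def by (intro compact_continuous_image continuous_intros K)
  obtain M0 where M0: "\<And>z. z \<in> K' \<Longrightarrow> cmod z \<le> M0"
    using compact_imp_bounded[OF K'] unfolding bounded_iff by blast
  define M where "M = max M0 \<rho>"
  have \<rho>1: "\<rho> > 1" using T by (simp add: \<rho>_def)
  have M: "M \<ge> \<rho>" "\<And>z. z \<in> K' \<Longrightarrow> cmod z \<le> M"
    using M0 by (auto simp: M_def le_max_iff_disj)
  \<comment> \<open>For this centre \<open>X\<close>, the bounds \<open>\<rho> \<le> Re z\<close> and \<open>\<bar>z\<bar> \<le> M\<close> give \<open>\<bar>X - z\<bar>\<^sup>2 \<le> X\<^sup>2 - M\<^sup>2\<close>, so that \<open>K'\<close>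
    lies well inside a disc in the right half plane, where the logarithm is analytic.\<close>
  define X where "X = M\<^sup>2 / \<rho>"
  have X0: "X > 0" using M \<rho>1 by (simp add: X_def)
  have MX: "M \<le> X" using M \<rho>1 by (simp add: X_def power2_eq_square le_divide_eq mult_left_mono)
  define r where "r = sqrt (X\<^sup>2 - M\<^sup>2)"
  have r: "r < X"
  proof -
    have "X\<^sup>2 - M\<^sup>2 < X\<^sup>2" using M \<rho>1 by simp
    then have "r < sqrt (X\<^sup>2)" unfolding r_def by (rule real_sqrt_less_mono)
    then show ?thesis using X0 by simp
  qed
  have K'_ball: "z \<in> cball (of_real X) r" if "z \<in> K'" for z
  proof -
    have "Re z \<ge> \<rho>" using that Re_E by (auto simp: K'_def)
    have "(cmod (of_real X - z))\<^sup>2 = X\<^sup>2 - 2 * X * Re z + (cmod z)\<^sup>2"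
      unfolding cmod_power2 by (simp add: power2_eq_square algebra_simps)
    also have "\<dots> \<le> X\<^sup>2 - 2 * X * \<rho> + M\<^sup>2"
      using \<open>Re z \<ge> \<rho>\<close> M(2)[OF that] X0 by (intro add_mono diff_mono power_mono) auto
    also have "\<dots> = X\<^sup>2 - M\<^sup>2" using \<rho>1 by (simp add: X_def)
    finally have "cmod (of_real X - z) \<le> r" unfolding r_def by (rule real_le_rsqrt)
    then show ?thesis by (simp add: dist_norm)
  qed
  define G where "G z = g (Ln z / of_real T)" for z
  have right_half: "Re z > 0" if "z \<in> ball (of_real X) X" for z
  proof -
    have "X - Re z \<le> cmod (of_real X - z)" using complex_Re_le_cmod[of "of_real X - z"] by simp
    then show ?thesis using that by (simp add: dist_norm)
  qed
  have "G holomorphic_on ball (of_real X) X"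
  proof -
    have "(g \<circ> (\<lambda>z. Ln z / of_real T)) holomorphic_on ball (of_real X) X"
      using right_half T(1)
      by (intro holomorphic_on_compose_gen[OF _ g] holomorphic_intros)
        (auto simp: complex_nonpos_Reals_iff dest!: right_half)
    then show ?thesis by (simp add: G_def[abs_def] o_def)
  qed
  from holomorphic_poly_approx[OF this r, of "\<epsilon>/2"]
  obtain P where "\<And>z. z \<in> cball (of_real X) r \<Longrightarrow> cmod (poly P z - G z) \<le> \<epsilon>/2"
    using \<epsilon> by auto
  then have P: "cmod (poly P z - G z) \<le> \<epsilon>/2" if "z \<in> K'" for z using K'_ball that by blast
  \<comment> \<open>The line \<open>Re z = c\<close> separates \<open>cball 0 r1\<close> from \<open>K'\<close>.\<close>
  define r1 where "r1 = (2 + \<rho>) / 3"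
  define c where "c = (1 + 2 * \<rho>) / 3"
  have r1: "r1 > 1" "r1 < c" "c < \<rho>" using \<rho>1 by (auto simp: r1_def c_def)
  have cpt: "compact (cball 0 r1 \<union> K')" by (intro compact_Un K' compact_cball)
  obtain B where B: "B > 0" "\<And>z. z \<in> cball 0 r1 \<union> K' \<Longrightarrow> cmod (poly P z) \<le> B"
    using poly_approximable_bounded[OF cpt poly_approximable_poly] by blast
  \<comment> \<open>The first bound serves the error on \<open>K'\<close>, the second one the sum of the coefficients.\<close>
  define \<eta> where "\<eta> = min (\<epsilon> / (2 * B)) (\<epsilon> / B * ((r1 - 1) / r1))"
  have \<eta>: "\<eta> > 0" "B * \<eta> \<le> \<epsilon>/2" "B * \<eta> * (r1 / (r1 - 1)) \<le> \<epsilon>"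
  proof -
    show "\<eta> > 0" using \<epsilon> B r1 by (simp add: \<eta>_def)
    have "\<eta> \<le> \<epsilon> / (2 * B)" by (simp add: \<eta>_def)
    then show "B * \<eta> \<le> \<epsilon>/2" using B by (simp add: field_simps)
    have "\<eta> \<le> \<epsilon> / B * ((r1 - 1) / r1)" by (simp add: \<eta>_def)
    then have "B * \<eta> * (r1 / (r1 - 1)) \<le> B * (\<epsilon> / B * ((r1 - 1) / r1)) * (r1 / (r1 - 1))"
      using B r1 by (intro mult_right_mono mult_left_mono) auto
    also have "\<dots> = \<epsilon>" using B r1 by simp
    finally show "B * \<eta> * (r1 / (r1 - 1)) \<le> \<epsilon>" .
  qed
  obtain Q where Q: "\<And>z. z \<in> cball 0 r1 \<Longrightarrow> cmod (poly Q z) \<le> \<eta>"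
    "\<And>z. z \<in> K' \<Longrightarrow> cmod (poly Q z - 1) \<le> \<eta>"
  proof (rule poly_separating_halfplanes[OF compact_cball K' \<eta>(1), of 0 r1 c])
    show "Re z < c" if "z \<in> cball 0 r1" for z
      using that complex_Re_le_cmod[of z] r1 by simp
    show "c < Re z" if "z \<in> K'" for z
      using that Re_E r1 by (force simp: K'_def)
  qed blast
  define W where "W = P * Q"
  have W_disc: "cmod (poly W z) \<le> B * \<eta>" if "cmod z \<le> r1" for z
    using that B(2)[of z] Q(1)[of z] B(1) by (auto simp: W_def norm_mult intro!: mult_mono)
  have W_K': "cmod (poly W z - G z) \<le> \<epsilon>" if z: "z \<in> K'" for z
  proof -
    have "poly W z - G z = poly P z * (poly Q z - 1) + (poly P z - G z)"
      by (simp add: W_def algebra_simps)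
    then have "cmod (poly W z - G z) \<le> cmod (poly P z) * cmod (poly Q z - 1) + cmod (poly P z - G z)"
      by (metis norm_mult norm_triangle_ineq)
    also have "\<dots> \<le> B * \<eta> + \<epsilon>/2"
      using B(2)[of z] Q(2)[OF z] P[OF z] z B(1) by (intro add_mono mult_mono) auto
    finally show ?thesis using \<eta>(2) by simp
  qed
  show ?thesis
  proof (rule that[of T "coeff W" "degree W", OF T(1)])
    show "\<forall>u\<in>K. cmod ((\<Sum>k\<le>degree W. coeff W k * exp (of_real (real k * T) * u)) - g u) \<le> \<epsilon>"
    proof
      fix u assume u: "u \<in> K"
      have "exp (of_real (real k * T) * u) = E u ^ k" for k
        by (simp add: E_def exp_of_nat_mult[symmetric] mult.assoc)
      then have "(\<Sum>k\<le>degree W. coeff W k * exp (of_real (real k * T) * u)) = poly W (E u)"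
        by (simp add: poly_altdef)
      moreover have "G (E u) = g u" using Ln_E[OF u] T(1) by (simp add: G_def)
      ultimately show "cmod ((\<Sum>k\<le>degree W. coeff W k * exp (of_real (real k * T) * u)) - g u) \<le> \<epsilon>"
        using W_K'[of "E u"] u by (simp add: K'_def)
    qed
  next
    show "(\<Sum>k\<le>degree W. cmod (coeff W k)) \<le> \<epsilon>"
      using poly_coeff_sum_le[OF r1(1) W_disc] \<eta>(3) by (rule order_trans)
  qed
qed

section \<open>Replacing real frequencies by logarithms of integers\<close>

text \<open>Since \<open>\<bar>u - k\<bar> \<le> R + k\<close>, the recursion in \<open>k\<close> makes \<open>R + k choose k\<close> a bound.\<close>

lemma norm_gbinomial_le:
  fixes u :: complex
  assumes u: "cmod u \<le> real R"
  shows "cmod (u gchoose k) \<le> 2 ^ (R + k)"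
proof -
  have "cmod (u gchoose k) \<le> real ((R + k) choose k)"
  proof (induction k)
    case (Suc k)
    have "cmod (u - of_nat k) \<le> real R + real k"
      using norm_triangle_ineq4[of u "of_nat k"] u by simp
    then have "cmod (u gchoose k) * cmod (u - of_nat k) \<le> real ((R + k) choose k) * real (Suc (R + k))"
      by (intro mult_mono Suc.IH) auto
    also have "\<dots> = real (Suc (R + k) choose Suc k) * real (Suc k)"
      using Suc_times_binomial_eq[of "R + k" k] by (metis mult.commute of_nat_mult)
    finally have "cmod ((u gchoose k) * (u - of_nat k)) \<le> real (Suc (R + k) choose Suc k) * real (Suc k)"
      by (simp add: norm_mult)
    moreover have "(u gchoose k) * (u - of_nat k) = of_nat (Suc k) * (u gchoose Suc k)"
      using gbinomial_mult_1[of u k] by (simp add: algebra_simps)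
    ultimately have "real (Suc k) * cmod (u gchoose Suc k) \<le> real (Suc k) * real (Suc (R + k) choose Suc k)"
      by (simp only: norm_mult norm_of_nat mult.commute)
    then show ?case by (simp del: binomial_Suc_Suc)
  qed simp
  also have "\<dots> \<le> real (2 ^ (R + k))"
    using binomial_le_pow2[of "R + k" k] by (simp only: of_nat_le_iff)
  finally show ?thesis by simp
qed

text \<open>The value at \<open>y\<close> of the \<open>i\<close>-th Lagrange basis polynomial for the nodes \<open>0, \<dots>, R\<close>.\<close>

definition lagrange_coeff :: "nat \<Rightarrow> nat \<Rightarrow> real \<Rightarrow> real" where
  "lagrange_coeff R i y = (\<Prod>j\<in>{..R} - {i}. (y - real j) / (real i - real j))"

lemma lagrange_coeff_at_node:
  assumes "i \<le> R" "m \<le> R"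
  shows "lagrange_coeff R i (real m) = (if i = m then 1 else 0)"
proof (cases "i = m")
  case False
  then show ?thesis using assms unfolding lagrange_coeff_def
    by (auto intro!: prod_zero)
qed (auto simp: lagrange_coeff_def intro!: prod.neutral)

text \<open>Both sides are polynomials in \<open>y\<close> of degree at most \<open>R\<close> that agree at the \<open>R + 1\<close> nodes.\<close>

lemma lagrange_power_exact:
  assumes k: "k \<le> R"
  shows "(\<Sum>i\<le>R. lagrange_coeff R i y * real i ^ k) = y ^ k"
proof -
  define L where "L i = (\<Prod>j\<in>{..R} - {i}. smult (1 / (real i - real j)) [:- real j, 1:])" for i
  define q where "q = (\<Sum>i\<le>R. smult (real i ^ k) (L i))"
  have L: "poly (L i) z = lagrange_coeff R i z" for i z
    by (simp add: L_def poly_prod lagrange_coeff_def diff_divide_distrib)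
  have q: "poly q z = (\<Sum>i\<le>R. lagrange_coeff R i z * real i ^ k)" for z
    by (simp add: q_def poly_sum L mult.commute)
  have "degree (L i) \<le> R" if "i \<le> R" for i
  proof -
    have "degree (L i) \<le> (\<Sum>j\<in>{..R} - {i}. degree (smult (1 / (real i - real j)) [:- real j, 1:]))"
      unfolding L_def by (rule degree_prod_sum_le[THEN order_trans]) (auto simp: o_def)
    also have "\<dots> \<le> (\<Sum>j\<in>{..R} - {i}. 1)" by (intro sum_mono) simp
    also have "\<dots> = R" using that by simp
    finally show ?thesis .
  qed
  then have "degree q \<le> R"
    unfolding q_def by (intro degree_sum_le) (auto intro: order_trans[OF degree_smult_le])
  moreover have "card (real ` {..R}) = Suc R" by (subst card_image) (auto simp: inj_on_def)
  moreover have node: "poly q (real m) = poly (monom 1 k) (real m)" if m: "m \<le> R" for m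
  proof -
    have "poly q (real m) = (\<Sum>i\<le>R. (if i = m then 1 else 0) * real i ^ k)"
      unfolding q by (intro sum.cong refl) (simp add: lagrange_coeff_at_node m)
    then show ?thesis using m by (simp add: poly_monom if_distrib[of "\<lambda>z. z * _"] cong: if_cong)
  qed
  ultimately have "q = monom 1 k"
    using k by (intro poly_eqI_degree[where A = "real ` {..R}"]) (auto simp: degree_monom_eq)
  then show ?thesis using q[of y] by (simp add: poly_monom)
qed

lemma lagrange_coeff_le:
  assumes "0 \<le> y" "y \<le> 1" "i \<le> R"
  shows "\<bar>lagrange_coeff R i y\<bar> \<le> (real R + 1) ^ R"
proof -
  have "\<bar>lagrange_coeff R i y\<bar> = (\<Prod>j\<in>{..R} - {i}. \<bar>y - real j\<bar> / \<bar>real i - real j\<bar>)"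
    by (simp add: lagrange_coeff_def abs_prod)
  also have "\<dots> \<le> (\<Prod>j\<in>{..R} - {i}. real R + 1)"
  proof (rule prod_mono)
    fix j assume j: "j \<in> {..R} - {i}"
    have "\<bar>y - real j\<bar> \<le> real R + 1" using j assms by auto
    moreover have "\<bar>real i - real j\<bar> \<ge> 1" using j by auto
    ultimately have "\<bar>y - real j\<bar> / \<bar>real i - real j\<bar> \<le> (real R + 1) / 1"
      by (intro frac_le) auto
    then show "0 \<le> \<bar>y - real j\<bar> / \<bar>real i - real j\<bar> \<and> \<bar>y - real j\<bar> / \<bar>real i - real j\<bar> \<le> real R + 1"
      by simp
  qed
  also have "\<dots> = (real R + 1) ^ R" using assms by simp
  finally show ?thesis .
qed

text \<open>The binomial series of \<open>(n + y) powr u\<close> is cut off at degree \<open>R \<ge> \<bar>u\<bar>\<close>, so that the factor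
  \<open>(y / n) ^ Suc R\<close> of the remainder absorbs the growth \<open>n ^ R\<close> of \<open>n powr u\<close>.\<close>

lemma powr_taylor_remainder:
  fixes u :: complex and n y :: real and R :: nat
  assumes u: "cmod u \<le> real R" and y: "0 \<le> y" "y \<le> real R + 1" and n: "n \<ge> 4 * (real R + 1)"
  shows "cmod (of_real (n + y) powr u
      - (\<Sum>k\<le>R. (u gchoose k) * of_real n powr (u - of_nat k) * of_real y ^ k))
    \<le> 2 * (4 * (real R + 1)) ^ Suc R"
proof -
  have n0: "n > 0" using n by simp
  define c where "c k = (u gchoose k) * of_real n powr (u - of_nat k) * of_real y ^ k" for k :: nat
  have sums: "c sums (of_real (n + y) powr u)"
    unfolding c_def using y n by (intro gen_binomial_complex'') auto
  define x where "x = 2 * y / n"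
  have x: "0 \<le> x" "x \<le> 1/2" using y n n0 by (auto simp: x_def field_simps)
  have n_powr: "n powr (Re u - real k) \<le> n ^ R / n ^ k" for k
  proof -
    have "n powr (Re u - real k) \<le> n powr (real R - real k)"
      using abs_Re_le_cmod[of u] u n by (intro powr_mono) auto
    also have "\<dots> = n ^ R / n ^ k" using n0 by (simp add: powr_diff powr_realpow)
    finally show ?thesis .
  qed
  have c_le: "cmod (c k) \<le> 2 ^ R * n ^ R * x ^ k" for k
  proof -
    have "cmod (c k) = cmod (u gchoose k) * n powr (Re u - real k) * y ^ k"
      using n0 y by (simp add: c_def norm_mult norm_power norm_powr_real_powr)
    also have "\<dots> \<le> 2 ^ (R + k) * (n ^ R / n ^ k) * y ^ k"
      by (intro mult_mono norm_gbinomial_le u n_powr) (use y n0 in auto)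
    also have "\<dots> = 2 ^ R * n ^ R * x ^ k"
      by (simp add: x_def power_add power_mult_distrib power_divide)
    finally show ?thesis .
  qed
  have geo: "(\<lambda>k. 2 ^ R * n ^ R * x ^ Suc R * x ^ k) sums (2 ^ R * n ^ R * x ^ Suc R * (1 / (1 - x)))"
    using x by (intro sums_mult geometric_sums) auto
  have shift: "(\<lambda>k. c (k + Suc R)) sums (of_real (n + y) powr u - (\<Sum>k<Suc R. c k))"
    using sums by (rule sums_split_initial_segment)
  have "cmod (of_real (n + y) powr u - (\<Sum>k<Suc R. c k)) = cmod (\<Sum>k. c (k + Suc R))"
    using shift by (simp add: sums_iff)
  also have "\<dots> \<le> (\<Sum>k. 2 ^ R * n ^ R * x ^ Suc R * x ^ k)"
  proof (rule norm_suminf_le)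
    show "cmod (c (k + Suc R)) \<le> 2 ^ R * n ^ R * x ^ Suc R * x ^ k" for k
      using c_le[of "k + Suc R"] by (simp add: power_add mult_ac)
  qed (use geo in \<open>rule sums_summable\<close>)
  also have "\<dots> = 2 ^ R * n ^ R * x ^ Suc R * (1 / (1 - x))" using geo by (rule sums_unique[symmetric])
  also have "\<dots> \<le> 2 ^ R * n ^ R * x ^ Suc R * 2"
    using x n0 by (intro mult_left_mono) (auto simp: field_simps)
  also have "\<dots> = 2 * (2 ^ R * ((n ^ R / n ^ Suc R) * (2 * y) ^ Suc R))"
    by (simp add: x_def power_divide)
  also have "\<dots> \<le> 2 * (2 ^ Suc R * (1 * (2 * (real R + 1)) ^ Suc R))"
  proof (intro mult_left_mono mult_mono power_mono)
    have "n ^ R / n ^ Suc R = 1 / n" using n0 by simp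
    also have "\<dots> \<le> 1" using n by simp
    finally show "n ^ R / n ^ Suc R \<le> 1" .
  qed (use y n0 in auto)
  also have "\<dots> = 2 * (2 * (2 * (real R + 1))) ^ Suc R"
    by (simp only: power_mult_distrib mult_1 mult.assoc)
  finally show ?thesis by (simp add: c_def lessThan_Suc_atMost)
qed

text \<open>Interpolating \<open>y \<mapsto> (n + y) powr u\<close>, with \<open>n = \<lfloor>x\<rfloor>\<close>, at the nodes \<open>0, \<dots>, R\<close> reproduces the Taylor
  polynomial of degree \<open>R\<close> exactly and has weights that are bounded independently of \<open>x\<close> and \<open>u\<close>.
  Only the remainders at \<open>x\<close> and at the nodes contribute to the error.\<close>

lemma integer_frequency_interpolation:
  fixes R :: nat
  obtains C :: real where "C \<ge> 1"
    and "\<And>x. x \<ge> C \<Longrightarrow> \<exists>b :: nat \<Rightarrow> real. (\<Sum>i\<le>R. \<bar>b i\<bar>) \<le> C \<and>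
      (\<forall>u. cmod u \<le> real R \<longrightarrow>
        cmod ((\<Sum>i\<le>R. of_real (b i) * of_nat (nat \<lfloor>x\<rfloor> + i) powr u) - of_real x powr u) \<le> C)"
proof -
  define A where "A = (real R + 1) ^ Suc R"
  define D where "D = 2 * (4 * (real R + 1)) ^ Suc R"
  define C where "C = (1 + A) * D + A + 4 * (real R + 1) + 1"
  have A0: "A \<ge> 0" "D \<ge> 0" "(1 + A) * D \<ge> 0" by (auto simp: A_def D_def)
  show ?thesis
  proof (rule that[of C])
    show "C \<ge> 1" using A0 by (simp add: C_def)
  next
    fix x assume x: "x \<ge> C"
    define n where "n = nat \<lfloor>x\<rfloor>"
    define \<theta> where "\<theta> = x - real n"
    have x_ge: "x \<ge> 4 * (real R + 1) + 1" using x A0 unfolding C_def by linarith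
    then have n_eq: "real n = of_int \<lfloor>x\<rfloor>" by (simp add: n_def)
    have \<theta>: "0 \<le> \<theta>" "\<theta> \<le> 1" unfolding \<theta>_def n_eq by linarith+
    have n: "real n \<ge> 4 * (real R + 1)" using \<theta> x_ge by (simp add: \<theta>_def)
    define b where "b i = lagrange_coeff R i \<theta>" for i
    have b_sum: "(\<Sum>i\<le>R. \<bar>b i\<bar>) \<le> A"
    proof -
      have "(\<Sum>i\<le>R. \<bar>b i\<bar>) \<le> (\<Sum>i\<le>R. (real R + 1) ^ R)"
        unfolding b_def by (intro sum_mono lagrange_coeff_le \<theta>) auto
      also have "\<dots> = A" by (simp add: A_def algebra_simps)
      finally show ?thesis .
    qed
    have "cmod ((\<Sum>i\<le>R. of_real (b i) * of_nat (n + i) powr u) - of_real x powr u) \<le> C"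
      if u: "cmod u \<le> real R" for u
    proof -
      define a where "a k = (u gchoose k) * of_real (real n) powr (u - of_nat k)" for k :: nat
      define P where "P y = (\<Sum>k\<le>R. a k * of_real y ^ k)" for y :: real
      define r where "r y = of_real (real n + y) powr u - P y" for y :: real
      have r_le: "cmod (r y) \<le> D" if "0 \<le> y" "y \<le> real R + 1" for y
        unfolding r_def P_def a_def D_def using powr_taylor_remainder[OF u that n] .
      have exact: "(\<Sum>i\<le>R. of_real (b i) * P (real i)) = P \<theta>"
      proof -
        have "(\<Sum>i\<le>R. of_real (b i) * P (real i))
            = (\<Sum>k\<le>R. a k * of_real (\<Sum>i\<le>R. b i * real i ^ k))"
          unfolding P_def sum_distrib_left of_real_sum
          by (subst sum.swap) (simp add: mult_ac)
        also have "\<dots> = P \<theta>"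
          unfolding P_def by (intro sum.cong refl) (simp add: b_def lagrange_power_exact)
        finally show ?thesis .
      qed
      have x_powr: "of_real x powr u = P \<theta> + r \<theta>"
        by (simp add: r_def \<theta>_def)
      have n_powr: "of_nat (n + i) powr u = P (real i) + r (real i)" for i
        by (simp add: r_def)
      have "(\<Sum>i\<le>R. of_real (b i) * of_nat (n + i) powr u) - of_real x powr u
          = (\<Sum>i\<le>R. of_real (b i) * r (real i)) - r \<theta>"
        unfolding x_powr n_powr distrib_left sum.distrib exact by simp
      also have "cmod \<dots> \<le> cmod (\<Sum>i\<le>R. of_real (b i) * r (real i)) + cmod (r \<theta>)"
        by (rule norm_triangle_ineq4)
      also have "\<dots> \<le> (\<Sum>i\<le>R. \<bar>b i\<bar> * D) + D"
        using \<theta> by (intro add_mono sum_norm_le r_le)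
          (auto simp: norm_mult intro!: mult_left_mono r_le)
      also have "\<dots> \<le> A * D + D"
        using b_sum A0 by (simp add: sum_distrib_right[symmetric] mult_right_mono)
      also have "\<dots> \<le> C" using A0 by (simp add: C_def algebra_simps)
      finally show ?thesis .
    qed
    moreover have "A \<le> C" using A0 by (simp add: C_def)
    ultimately show "\<exists>b :: nat \<Rightarrow> real. (\<Sum>i\<le>R. \<bar>b i\<bar>) \<le> C \<and>
      (\<forall>u. cmod u \<le> real R \<longrightarrow>
        cmod ((\<Sum>i\<le>R. of_real (b i) * of_nat (nat \<lfloor>x\<rfloor> + i) powr u) - of_real x powr u) \<le> C)"
      using b_sum unfolding n_def by (intro exI[of _ b]) auto
  qed
qed

section \<open>Dirichlet polynomials that are small in norm and prescribed to the left\<close>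

text \<open>A sum over arbitrary frequencies \<open>m j\<close>, in which an integer may occur several times, is turned into
  a Dirichlet polynomial; collecting equal frequencies does not increase the norm. The substitution
  \<open>u = \<sigma> - s\<close> accounts for the factor \<open>n powr \<sigma>\<close>.\<close>

lemma collect_dirichlet_coeffs:
  fixes m :: "'i \<Rightarrow> nat" and w :: "'i \<Rightarrow> complex" and \<sigma> :: real
  assumes I: "finite I" and m: "\<And>j. j \<in> I \<Longrightarrow> 0 < m j \<and> m j \<le> M"
  defines "a \<equiv> \<lambda>n. of_real (real n powr \<sigma>) * (\<Sum>j\<in>{j \<in> I. m j = n}. w j)"
  shows collect_dirichlet_coeffs_norm:
      "(\<Sum>n=1..M. cmod (a n) * real n powr (-\<sigma>)) \<le> (\<Sum>j\<in>I. cmod (w j))"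
    and collect_dirichlet_coeffs_sum: "dirichlet_partial_sum a M s = (\<Sum>j\<in>I. w j * of_nat (m j) powr (of_real \<sigma> - s))"
proof -
  have range: "m ` I \<subseteq> {1..M}" using m by force
  have "(\<Sum>n=1..M. cmod (a n) * real n powr (-\<sigma>)) = (\<Sum>n=1..M. cmod (\<Sum>j\<in>{j \<in> I. m j = n}. w j))"
    by (intro sum.cong refl) (auto simp: a_def norm_mult powr_minus field_simps)
  also have "\<dots> \<le> (\<Sum>n=1..M. \<Sum>j\<in>{j \<in> I. m j = n}. cmod (w j))"
    by (intro sum_mono norm_sum)
  also have "\<dots> = (\<Sum>j\<in>I. cmod (w j))" using I range by (intro sum.group) auto
  finally show "(\<Sum>n=1..M. cmod (a n) * real n powr (-\<sigma>)) \<le> (\<Sum>j\<in>I. cmod (w j))" .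
  have "dirichlet_partial_sum a M s
      = (\<Sum>n=1..M. \<Sum>j\<in>{j \<in> I. m j = n}. w j * of_nat (m j) powr (of_real \<sigma> - s))"
    unfolding dirichlet_partial_sum_def
  proof (rule sum.cong[OF refl])
    fix n assume n: "n \<in> {1..M}"
    have "of_real (real n powr \<sigma>) = (of_nat n :: complex) powr of_real \<sigma>"
      using powr_of_real[of "real n" \<sigma>] by simp
    then have "of_real (real n powr \<sigma>) * of_nat n powr (-s) = (of_nat n :: complex) powr (of_real \<sigma> - s)"
      by (simp add: powr_add[symmetric])
    then have "a n * of_nat n powr (-s)
        = (\<Sum>j\<in>{j \<in> I. m j = n}. w j) * of_nat n powr (of_real \<sigma> - s)"
      by (simp add: a_def mult_ac)
    also have "\<dots> = (\<Sum>j\<in>{j \<in> I. m j = n}. w j * of_nat (m j) powr (of_real \<sigma> - s))"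
      by (simp add: sum_distrib_right)
    finally show "a n * of_nat n powr (-s)
        = (\<Sum>j\<in>{j \<in> I. m j = n}. w j * of_nat (m j) powr (of_real \<sigma> - s))" .
  qed
  also have "\<dots> = (\<Sum>j\<in>I. w j * of_nat (m j) powr (of_real \<sigma> - s))"
    using I range by (intro sum.group) auto
  finally show "dirichlet_partial_sum a M s = (\<Sum>j\<in>I. w j * of_nat (m j) powr (of_real \<sigma> - s))" .
qed

text \<open>The order of the choices matters. The integer frequencies must exceed \<open>N\<close> and the threshold \<open>C\<close> of
  the interpolation, so a base frequency \<open>X\<close> is fixed beforehand, and the exponential sum is made to
  approximate \<open>g\<close> divided by \<open>X powr u\<close>. Multiplication by \<open>X powr u\<close> costs a factor \<open>X ^ R\<close>, and the
  interpolation costs a factor \<open>C\<close>; both are known before the precision \<open>\<eta>\<close> is chosen.\<close>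

lemma dirichlet_polynomial_approx:
  assumes K: "compact K" and left: "\<And>s. s \<in> K \<Longrightarrow> Re s < \<sigma>"
    and g: "g holomorphic_on UNIV" and \<epsilon>: "\<epsilon> > 0"
  obtains a M where "\<And>n. a n \<noteq> 0 \<Longrightarrow> N < n \<and> n \<le> M"
    and "(\<Sum>n=1..M. cmod (a n) * real n powr (-\<sigma>)) \<le> \<epsilon>"
    and "\<And>s. s \<in> K \<Longrightarrow> cmod (dirichlet_partial_sum a M s - g s) \<le> \<epsilon>"
proof -
  define K' where "K' = (\<lambda>s. of_real \<sigma> - s) ` K"
  have K': "compact K'" "\<And>u. u \<in> K' \<Longrightarrow> Re u > 0"
    using left unfolding K'_def by (auto intro!: compact_continuous_image K continuous_intros)
  obtain R0 where R0: "\<And>u. u \<in> K' \<Longrightarrow> cmod u \<le> R0"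
    using compact_imp_bounded[OF K'(1)] unfolding bounded_iff by blast
  obtain R :: nat where "R0 \<le> real R" using real_arch_simple by blast
  with R0 have R: "cmod u \<le> real R" if "u \<in> K'" for u using that order_trans by blast
  obtain C where C: "C \<ge> 1"
    "\<And>x. x \<ge> C \<Longrightarrow> \<exists>b :: nat \<Rightarrow> real. (\<Sum>i\<le>R. \<bar>b i\<bar>) \<le> C \<and>
      (\<forall>u. cmod u \<le> real R \<longrightarrow>
        cmod ((\<Sum>i\<le>R. of_real (b i) * of_nat (nat \<lfloor>x\<rfloor> + i) powr u) - of_real x powr u) \<le> C)"
    using integer_frequency_interpolation[of R] by blast
  define X where "X = C + real N + 1"
  have X: "X > 1" "X \<ge> C" "X \<ge> real N + 1" using C(1) by (auto simp: X_def)
  define \<eta> where "\<eta> = \<epsilon> / (C + X ^ R)"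
  have CX: "C + X ^ R > 0" using C(1) X by (intro add_pos_nonneg) auto
  have \<eta>: "\<eta> > 0" "(C + X ^ R) * \<eta> = \<epsilon>" using \<epsilon> CX by (auto simp: \<eta>_def)
  have \<eta>C: "C * \<eta> \<le> \<epsilon>"
    using \<eta> X C(1) by (simp add: \<eta>(2)[symmetric] algebra_simps)
  define g' where "g' u = g (of_real \<sigma> - u) * exp (- u * of_real (ln X))" for u
  have "(g \<circ> (\<lambda>u. of_real \<sigma> - u)) holomorphic_on UNIV"
    by (intro holomorphic_on_compose_gen[OF _ g] holomorphic_intros) auto
  then have g': "g' holomorphic_on UNIV"
    unfolding g'_def[abs_def] by (auto simp: o_def intro!: holomorphic_intros)
  obtain T d q where T: "T > 0"
    and q: "\<forall>u\<in>K'. cmod ((\<Sum>k\<le>d. q k * exp (of_real (real k * T) * u)) - g' u) \<le> \<eta>"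
    and q_sum: "(\<Sum>k\<le>d. cmod (q k)) \<le> \<eta>"
    by (rule exp_sum_approx[OF K' g' \<eta>(1)], assumption) (rule that; assumption)
  define x where "x k = X * exp (real k * T)" for k :: nat
  have x_mono: "x k \<le> x l" if "k \<le> l" for k l
    using that X T by (simp add: x_def)
  have x0: "x 0 = X" by (simp add: x_def)
  have x_ge: "x k \<ge> X" for k using x_mono[of 0 k] x0 by simp
  have "\<forall>k. \<exists>b :: nat \<Rightarrow> real. (\<Sum>i\<le>R. \<bar>b i\<bar>) \<le> C \<and> (\<forall>u. cmod u \<le> real R \<longrightarrow>
      cmod ((\<Sum>i\<le>R. of_real (b i) * of_nat (nat \<lfloor>x k\<rfloor> + i) powr u) - of_real (x k) powr u) \<le> C)"
    using C(2) x_ge X order_trans by blast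
  then obtain b :: "nat \<Rightarrow> nat \<Rightarrow> real" where b_sum: "\<And>k. (\<Sum>i\<le>R. \<bar>b k i\<bar>) \<le> C"
    and b: "\<And>k u. cmod u \<le> real R \<Longrightarrow>
      cmod ((\<Sum>i\<le>R. of_real (b k i) * of_nat (nat \<lfloor>x k\<rfloor> + i) powr u) - of_real (x k) powr u) \<le> C"
    unfolding choice_iff by blast
  define I where "I = {..d} \<times> {..R}"
  define m where "m j = nat \<lfloor>x (fst j)\<rfloor> + snd j" for j :: "nat \<times> nat"
  define w where "w j = q (fst j) * of_real (b (fst j) (snd j))" for j
  define M where "M = nat \<lfloor>x d\<rfloor> + R"
  define a where "a n = of_real (real n powr \<sigma>) * (\<Sum>j\<in>{j \<in> I. m j = n}. w j)" for n
  have I: "finite I" by (simp add: I_def)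
  have m: "N < m j \<and> m j \<le> M" if "j \<in> I" for j
  proof
    have "real N + 1 \<le> x (fst j)" using x_ge[of "fst j"] X by linarith
    then have "int N < \<lfloor>x (fst j)\<rfloor>" by linarith
    then show "N < m j" by (simp add: m_def)
    have "\<lfloor>x (fst j)\<rfloor> \<le> \<lfloor>x d\<rfloor>" using that by (intro floor_mono x_mono) (auto simp: I_def)
    then show "m j \<le> M" using that by (auto simp: m_def M_def I_def intro!: add_mono nat_mono)
  qed
  then have m': "0 < m j \<and> m j \<le> M" if "j \<in> I" for j using that by fastforce
  show ?thesis
  proof (rule that[of a M])
    show "N < n \<and> n \<le> M" if "a n \<noteq> 0" for n
    proof -
      have "{j \<in> I. m j = n} \<noteq> {}" using that unfolding a_def by (intro notI) simp
      then show ?thesis using m by blast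
    qed
  next
    have "(\<Sum>n=1..M. cmod (a n) * real n powr (-\<sigma>)) \<le> (\<Sum>j\<in>I. cmod (w j))"
      unfolding a_def by (rule collect_dirichlet_coeffs_norm[OF I m'])
    also have "\<dots> = (\<Sum>k\<le>d. cmod (q k) * (\<Sum>i\<le>R. \<bar>b k i\<bar>))"
      unfolding I_def w_def
      by (simp add: sum.cartesian_product norm_mult sum_distrib_left case_prod_beta')
    also have "\<dots> \<le> (\<Sum>k\<le>d. cmod (q k) * C)"
      by (intro sum_mono mult_left_mono b_sum) auto
    also have "\<dots> \<le> \<eta> * C"
      using q_sum C(1) by (simp add: sum_distrib_right[symmetric] mult_right_mono)
    finally show "(\<Sum>n=1..M. cmod (a n) * real n powr (-\<sigma>)) \<le> \<epsilon>"
      using \<eta>C by (simp add: mult.commute)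
  next
    fix s assume s: "s \<in> K"
    define u where "u = of_real \<sigma> - s"
    have u: "u \<in> K'" using s by (auto simp: K'_def u_def)
    define B where "B k = (\<Sum>i\<le>R. of_real (b k i) * of_nat (nat \<lfloor>x k\<rfloor> + i) powr u)" for k
    have "dirichlet_partial_sum a M s = (\<Sum>j\<in>I. w j * of_nat (m j) powr u)"
      unfolding a_def u_def by (rule collect_dirichlet_coeffs_sum[OF I m'])
    also have "\<dots> = (\<Sum>k\<le>d. q k * B k)"
      unfolding I_def w_def m_def B_def
      by (simp add: sum.cartesian_product sum_distrib_left case_prod_beta' mult.assoc)
    finally have S: "dirichlet_partial_sum a M s = (\<Sum>k\<le>d. q k * B k)" .
    have x_powr: "of_real (x k) powr u = exp (u * of_real (ln X)) * exp (of_real (real k * T) * u)" for k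
    proof -
      have "ln (x k) = ln X + real k * T" using X by (simp add: x_def ln_mult)
      moreover have "x k > 0" using x_ge[of k] X by linarith
      ultimately show ?thesis
        by (simp add: powr_def Ln_of_real exp_add[symmetric] algebra_simps)
    qed
    define D where "D = (\<Sum>k\<le>d. q k * exp (of_real (real k * T) * u)) - g' u"
    have g_eq: "g s = exp (u * of_real (ln X)) * g' u"
    proof -
      have "exp (u * of_real (ln X)) * exp (- u * of_real (ln X)) = 1"
        by (simp add: exp_add[symmetric])
      moreover have "g' u = g s * exp (- u * of_real (ln X))" by (simp add: g'_def u_def)
      ultimately show ?thesis by (simp only: mult.left_commute[of _ "g s"] mult_1_right)
    qed
    have "dirichlet_partial_sum a M s - g s
        = (\<Sum>k\<le>d. q k * (B k - of_real (x k) powr u)) + exp (u * of_real (ln X)) * D"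
      unfolding S g_eq D_def x_powr
      by (simp add: right_diff_distrib sum_subtractf sum_distrib_left mult_ac)
    also have "cmod \<dots> \<le> cmod (\<Sum>k\<le>d. q k * (B k - of_real (x k) powr u))
        + cmod (exp (u * of_real (ln X)) * D)"
      by (rule norm_triangle_ineq)
    also have "\<dots> \<le> (\<Sum>k\<le>d. cmod (q k) * C) + X ^ R * \<eta>"
    proof (intro add_mono sum_norm_le)
      show "cmod (q k * (B k - of_real (x k) powr u)) \<le> cmod (q k) * C" for k
        unfolding norm_mult B_def using b[OF R[OF u]] by (intro mult_left_mono) auto
      have "cmod (exp (u * of_real (ln X))) \<le> exp (real R * ln X)"
        using complex_Re_le_cmod[of u] R[OF u] X by (simp add: mult_right_mono)
      also have "\<dots> = X ^ R" using X by (simp add: exp_of_nat_mult)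
      finally show "cmod (exp (u * of_real (ln X)) * D) \<le> X ^ R * \<eta>"
        unfolding norm_mult using bspec[OF q u] X by (intro mult_mono) (auto simp: D_def)
    qed
    also have "\<dots> \<le> \<eta> * C + X ^ R * \<eta>"
      using q_sum C(1) by (simp add: sum_distrib_right[symmetric] mult_right_mono)
    also have "\<dots> = \<epsilon>" using \<eta>(2) by (simp add: algebra_simps)
    finally show "cmod (dirichlet_partial_sum a M s - g s) \<le> \<epsilon>" .
  qed
qed

text \<open>Each compact subset of the closed left half plane lies in the half disc of radius \<open>k\<close> for large \<open>k\<close>,
  so a single parameter can bound both the order of the derivatives and the size of the set.\<close>

definition jets_close :: "nat \<Rightarrow> real \<Rightarrow> (complex \<Rightarrow> complex) \<Rightarrow> (complex \<Rightarrow> complex) \<Rightarrow> bool" where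
  "jets_close k \<epsilon> f g \<longleftrightarrow> (\<forall>l\<le>k. \<forall>s. Re s \<le> 0 \<and> cmod s \<le> real k \<longrightarrow>
     cmod ((deriv ^^ l) f s - (deriv ^^ l) g s) \<le> \<epsilon>)"

lemma jets_close_of_close:
  fixes r \<epsilon> :: real
  assumes r: "r > 0" and \<epsilon>: "\<epsilon> > 0"
  obtains \<eta> where "\<eta> > 0" and "\<And>f g. \<lbrakk>f holomorphic_on UNIV; g holomorphic_on UNIV;
      \<And>s. Re s \<le> r \<Longrightarrow> cmod s \<le> real k + r \<Longrightarrow> cmod (f s - g s) \<le> \<eta>\<rbrakk> \<Longrightarrow> jets_close k \<epsilon> f g"
proof (rule that[of "\<epsilon> * min 1 r ^ k / fact k"])
  show "0 < \<epsilon> * min 1 r ^ k / fact k" using r \<epsilon> by simp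
next
  fix f g :: "complex \<Rightarrow> complex"
  assume f: "f holomorphic_on UNIV" and g: "g holomorphic_on UNIV"
    and close: "\<And>s. Re s \<le> r \<Longrightarrow> cmod s \<le> real k + r \<Longrightarrow> cmod (f s - g s) \<le> \<epsilon> * min 1 r ^ k / fact k"
  show "jets_close k \<epsilon> f g"
    unfolding jets_close_def
  proof (intro allI impI)
    fix l s assume l: "l \<le> k" and s: "Re s \<le> 0 \<and> cmod s \<le> real k"
    have "cmod ((deriv ^^ l) (\<lambda>z. f z - g z) s) \<le> fact l * (\<epsilon> * min 1 r ^ k / fact k) / r ^ l"
    proof (rule Cauchy_inequality[OF _ _ r])
      show "(\<lambda>z. f z - g z) holomorphic_on ball s r"
        by (rule holomorphic_on_subset[OF holomorphic_on_diff[OF f g]]) simp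
      show "continuous_on (cball s r) (\<lambda>z. f z - g z)"
        by (rule holomorphic_on_imp_continuous_on,
            rule holomorphic_on_subset[OF holomorphic_on_diff[OF f g]]) simp
      show "cmod (f z - g z) \<le> \<epsilon> * min 1 r ^ k / fact k" if z: "cmod (s - z) = r" for z
      proof (rule close)
        show "Re z \<le> r" using abs_Re_le_cmod[of "s - z"] z s by (simp add: abs_le_iff)
        show "cmod z \<le> real k + r" using norm_triangle_ineq4[of s "s - z"] z s by simp
      qed
    qed
    also have "\<dots> = \<epsilon> * ((fact l / fact k) * (min 1 r ^ k / r ^ l))" by simp
    also have "\<dots> \<le> \<epsilon> * (1 * 1)"
    proof (intro mult_left_mono mult_mono)
      show "fact l / fact k \<le> (1 :: real)" using l by (simp add: fact_mono)
      have "min 1 r ^ k \<le> min 1 r ^ l" using l r by (intro power_decreasing) auto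
      also have "\<dots> \<le> r ^ l" using r by (intro power_mono) auto
      finally show "min 1 r ^ k / r ^ l \<le> 1" using r by simp
    qed (use r \<epsilon> in auto)
    finally show "cmod ((deriv ^^ l) f s - (deriv ^^ l) g s) \<le> \<epsilon>"
      using higher_deriv_diff[OF f g open_UNIV, of s l] by simp
  qed
qed

lemma holomorphic_dirichlet_partial_sum: "dirichlet_partial_sum a N holomorphic_on UNIV"
  unfolding dirichlet_partial_sum_def[abs_def] by (intro holomorphic_intros) auto

text \<open>The gap between \<open>Re s \<le> 0\<close> and \<open>Re s < \<sigma>\<close> leaves room for discs of radius \<open>\<sigma> / 2\<close> around all
  points of the half disc, on which Cauchy's estimates turn closeness into closeness of derivatives.\<close>

lemma dirichlet_block:
  assumes \<sigma>: "\<sigma> > 0" and g: "g holomorphic_on UNIV" and \<epsilon>: "\<epsilon> > 0"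
  shows "\<exists>a M. (\<forall>n. a n \<noteq> 0 \<longrightarrow> N < n \<and> n \<le> M) \<and>
    (\<Sum>n=1..M. cmod (a n) * real n powr (-\<sigma>)) \<le> \<epsilon> \<and>
    jets_close k \<epsilon> (dirichlet_partial_sum a M) g"
proof -
  obtain \<eta> where \<eta>: "\<eta> > 0" and close: "\<And>f g. \<lbrakk>f holomorphic_on UNIV; g holomorphic_on UNIV;
      \<And>s. Re s \<le> \<sigma>/2 \<Longrightarrow> cmod s \<le> real k + \<sigma>/2 \<Longrightarrow> cmod (f s - g s) \<le> \<eta>\<rbrakk> \<Longrightarrow> jets_close k \<epsilon> f g"
    using jets_close_of_close[of "\<sigma>/2" \<epsilon> k] \<sigma> \<epsilon> by (metis half_gt_zero)
  define K where "K = {s. Re s \<le> \<sigma>/2} \<inter> cball 0 (real k + \<sigma>/2)"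
  have K: "compact K" unfolding K_def
    by (intro closed_Int_compact compact_cball closed_halfspace_Re_le)
  have K_left: "Re s < \<sigma>" if "s \<in> K" for s using that \<sigma> by (simp add: K_def)
  have min_pos: "min \<epsilon> \<eta> > 0" using \<epsilon> \<eta> by simp
  obtain a M where a: "\<And>n. a n \<noteq> 0 \<Longrightarrow> N < n \<and> n \<le> M"
    "(\<Sum>n=1..M. cmod (a n) * real n powr (-\<sigma>)) \<le> min \<epsilon> \<eta>"
    "\<And>s. s \<in> K \<Longrightarrow> cmod (dirichlet_partial_sum a M s - g s) \<le> min \<epsilon> \<eta>"
    by (rule dirichlet_polynomial_approx[OF K K_left g min_pos, of N], assumption) (rule that; blast)
  have "jets_close k \<epsilon> (dirichlet_partial_sum a M) g"
    using a(3) by (intro close holomorphic_dirichlet_partial_sum g) (auto simp: K_def)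
  moreover have "(\<Sum>n=1..M. cmod (a n) * real n powr (-\<sigma>)) \<le> \<epsilon>" using a(2) by simp
  ultimately show ?thesis using a(1) by (intro exI[of _ a] exI[of _ M]) blast
qed

section \<open>The semi-norms and the topology\<close>

lemma abs_conv_dirichlet_summable:
  "a \<in> abs_conv_dirichlet \<Longrightarrow> \<sigma> > 0 \<Longrightarrow> summable (\<lambda>n. cmod (a n) * real n powr (-\<sigma>))"
  by (simp add: abs_conv_dirichlet_def)

lemma abs_conv_dirichlet_diff:
  assumes "a \<in> abs_conv_dirichlet" "b \<in> abs_conv_dirichlet"
  shows "a - b \<in> abs_conv_dirichlet"
proof -
  interpret vector_space dirichlet_scale by (rule vector_space_dirichlet_scale)
  show ?thesis using subspace_diff[OF subspace_abs_conv_dirichlet assms] .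
qed

lemma sum_le_dirichlet_seminorm:
  assumes "a \<in> abs_conv_dirichlet" "\<sigma> > 0" "finite A"
  shows "(\<Sum>n\<in>A. cmod (a n) * real n powr (-\<sigma>)) \<le> dirichlet_seminorm \<sigma> a"
  unfolding dirichlet_seminorm_def
  using assms by (intro sum_le_suminf abs_conv_dirichlet_summable) auto

lemma dirichlet_seminorm_triangle:
  assumes "a \<in> abs_conv_dirichlet" "b \<in> abs_conv_dirichlet" "c \<in> abs_conv_dirichlet" "\<sigma> > 0"
  shows "dirichlet_seminorm \<sigma> (c - a) \<le> dirichlet_seminorm \<sigma> (c - b) + dirichlet_seminorm \<sigma> (b - a)"
proof -
  note s = abs_conv_dirichlet_summable[OF abs_conv_dirichlet_diff \<open>\<sigma> > 0\<close>]
  have "cmod ((c - a) n) * real n powr (-\<sigma>)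
      \<le> cmod ((c - b) n) * real n powr (-\<sigma>) + cmod ((b - a) n) * real n powr (-\<sigma>)" for n
    using mult_right_mono[OF norm_triangle_ineq[of "(c - b) n" "(b - a) n"], of "real n powr (-\<sigma>)"]
    by (simp add: distrib_right)
  then have "dirichlet_seminorm \<sigma> (c - a)
      \<le> (\<Sum>n. cmod ((c - b) n) * real n powr (-\<sigma>) + cmod ((b - a) n) * real n powr (-\<sigma>))"
    unfolding dirichlet_seminorm_def using assms by (intro suminf_le summable_add s) auto
  also have "\<dots> = dirichlet_seminorm \<sigma> (c - b) + dirichlet_seminorm \<sigma> (b - a)"
    unfolding dirichlet_seminorm_def using assms by (intro suminf_add[symmetric] s) auto
  finally show ?thesis .
qed

lemma dirichlet_seminorm_antimono:
  assumes "a \<in> abs_conv_dirichlet" "0 < \<sigma>" "\<sigma> \<le> \<tau>"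
  shows "dirichlet_seminorm \<tau> a \<le> dirichlet_seminorm \<sigma> a"
  unfolding dirichlet_seminorm_def
proof (rule suminf_le)
  show "cmod (a n) * real n powr (-\<tau>) \<le> cmod (a n) * real n powr (-\<sigma>)" for n
    using assms by (cases "n = 0") (auto intro!: mult_left_mono powr_mono)
qed (use assms in \<open>auto intro: abs_conv_dirichlet_summable\<close>)

text \<open>The semi-norms decrease in \<open>\<sigma>\<close>, so a single one of them suffices for a basic neighbourhood.\<close>

lemma openin_abs_conv_dirichlet_topology:
  "openin abs_conv_dirichlet_topology U \<longleftrightarrow> U \<subseteq> abs_conv_dirichlet \<and>
    (\<forall>a\<in>U. \<exists>\<sigma>>0. \<exists>\<epsilon>>0. \<forall>b\<in>abs_conv_dirichlet. dirichlet_seminorm \<sigma> (b - a) < \<epsilon> \<longrightarrow> b \<in> U)"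
    (is "_ \<longleftrightarrow> ?open U")
proof
  let ?\<B> = "{{b \<in> abs_conv_dirichlet. dirichlet_seminorm \<sigma> (b - a) < \<epsilon>} | a \<sigma> \<epsilon>.
        a \<in> abs_conv_dirichlet \<and> \<sigma> > 0 \<and> \<epsilon> > 0}"
  assume "openin abs_conv_dirichlet_topology U"
  then have "generate_topology_on ?\<B> U"
    unfolding abs_conv_dirichlet_topology_def by (rule openin_topology_generated_by)
  then show "?open U"
  proof (rule generate_topology_on_coarsest[rotated 2])
    show "istopology ?open"
      unfolding istopology_def
    proof (intro conjI allI impI)
      fix U V assume U: "?open U" and V: "?open V"
      show "U \<inter> V \<subseteq> abs_conv_dirichlet" using U by blast
      show "\<forall>a\<in>U \<inter> V. \<exists>\<sigma>>0. \<exists>\<epsilon>>0. \<forall>b\<in>abs_conv_dirichlet.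
          dirichlet_seminorm \<sigma> (b - a) < \<epsilon> \<longrightarrow> b \<in> U \<inter> V"
      proof
        fix a assume a: "a \<in> U \<inter> V"
        then have aD: "a \<in> abs_conv_dirichlet" using U by blast
        obtain \<sigma> \<epsilon> where 1: "\<sigma> > 0" "\<epsilon> > 0"
          "\<And>b. b \<in> abs_conv_dirichlet \<Longrightarrow> dirichlet_seminorm \<sigma> (b - a) < \<epsilon> \<Longrightarrow> b \<in> U"
          using U a by blast
        obtain \<tau> \<delta> where 2: "\<tau> > 0" "\<delta> > 0"
          "\<And>b. b \<in> abs_conv_dirichlet \<Longrightarrow> dirichlet_seminorm \<tau> (b - a) < \<delta> \<Longrightarrow> b \<in> V"
          using V a by blast
        have "b \<in> U \<inter> V" if b: "b \<in> abs_conv_dirichlet"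
          and lt: "dirichlet_seminorm (min \<sigma> \<tau>) (b - a) < min \<epsilon> \<delta>" for b
        proof -
          have "dirichlet_seminorm \<sigma> (b - a) \<le> dirichlet_seminorm (min \<sigma> \<tau>) (b - a)"
            "dirichlet_seminorm \<tau> (b - a) \<le> dirichlet_seminorm (min \<sigma> \<tau>) (b - a)"
            using 1 2 by (auto intro!: dirichlet_seminorm_antimono[OF abs_conv_dirichlet_diff[OF b aD]])
          then show ?thesis using lt 1(3)[OF b] 2(3)[OF b] by auto
        qed
        then show "\<exists>\<sigma>>0. \<exists>\<epsilon>>0. \<forall>b\<in>abs_conv_dirichlet.
            dirichlet_seminorm \<sigma> (b - a) < \<epsilon> \<longrightarrow> b \<in> U \<inter> V"
          using 1 2 by (intro exI[of _ "min \<sigma> \<tau>"] conjI exI[of _ "min \<epsilon> \<delta>"]) auto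
      qed
    next
      fix \<U> assume \<U>: "\<forall>U\<in>\<U>. ?open U"
      then show "\<Union>\<U> \<subseteq> abs_conv_dirichlet" by blast
      show "\<forall>a\<in>\<Union>\<U>. \<exists>\<sigma>>0. \<exists>\<epsilon>>0. \<forall>b\<in>abs_conv_dirichlet.
          dirichlet_seminorm \<sigma> (b - a) < \<epsilon> \<longrightarrow> b \<in> \<Union>\<U>"
      proof
        fix a assume "a \<in> \<Union>\<U>"
        then obtain U where U: "U \<in> \<U>" "a \<in> U" by blast
        with \<U> obtain \<sigma> \<epsilon> where "\<sigma> > 0" "\<epsilon> > 0"
          "\<forall>b\<in>abs_conv_dirichlet. dirichlet_seminorm \<sigma> (b - a) < \<epsilon> \<longrightarrow> b \<in> U" by blast
        with U show "\<exists>\<sigma>>0. \<exists>\<epsilon>>0. \<forall>b\<in>abs_conv_dirichlet.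
          dirichlet_seminorm \<sigma> (b - a) < \<epsilon> \<longrightarrow> b \<in> \<Union>\<U>" by blast
      qed
    qed
  next
    fix U assume "U \<in> ?\<B>"
    then obtain c \<sigma> \<epsilon> where c: "c \<in> abs_conv_dirichlet" and \<sigma>: "\<sigma> > 0"
      and U: "U = {b \<in> abs_conv_dirichlet. dirichlet_seminorm \<sigma> (b - c) < \<epsilon>}" by blast
    show "?open U"
    proof (intro conjI ballI)
      fix a assume a: "a \<in> U"
      have "b \<in> U" if b: "b \<in> abs_conv_dirichlet"
        and "dirichlet_seminorm \<sigma> (b - a) < \<epsilon> - dirichlet_seminorm \<sigma> (a - c)" for b
        using dirichlet_seminorm_triangle[OF c, of a b \<sigma>] a that \<sigma> by (simp add: U)
      moreover have "\<epsilon> - dirichlet_seminorm \<sigma> (a - c) > 0" using a by (simp add: U)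
      ultimately show "\<exists>\<sigma>>0. \<exists>\<epsilon>>0. \<forall>b\<in>abs_conv_dirichlet. dirichlet_seminorm \<sigma> (b - a) < \<epsilon> \<longrightarrow> b \<in> U"
        using \<sigma> by blast
    qed (simp add: U)
  qed
next
  assume U: "?open U"
  have "\<exists>V. openin abs_conv_dirichlet_topology V \<and> a \<in> V \<and> V \<subseteq> U" if a: "a \<in> U" for a
  proof -
    have aD: "a \<in> abs_conv_dirichlet" using U a by blast
    obtain \<sigma> \<epsilon> where 1: "\<sigma> > 0" "\<epsilon> > 0"
      "\<forall>b\<in>abs_conv_dirichlet. dirichlet_seminorm \<sigma> (b - a) < \<epsilon> \<longrightarrow> b \<in> U" using U a by blast
    define V where "V = {b \<in> abs_conv_dirichlet. dirichlet_seminorm \<sigma> (b - a) < \<epsilon>}"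
    have "openin abs_conv_dirichlet_topology V"
      unfolding abs_conv_dirichlet_topology_def V_def
      using aD 1 by (intro topology_generated_by_Basis) blast
    moreover have "a \<in> V" using aD 1 by (simp add: V_def dirichlet_seminorm_def)
    moreover have "V \<subseteq> U" using 1 by (auto simp: V_def)
    ultimately show ?thesis by blast
  qed
  then show "openin abs_conv_dirichlet_topology U" by (subst openin_subopen) blast
qed

section \<open>Reduction of universality to countably many open conditions\<close>

definition complex_of_rats :: "rat \<times> rat \<Rightarrow> complex" where
  "complex_of_rats r = Complex (of_rat (fst r)) (of_rat (snd r))"

definition rat_poly :: "(rat \<times> rat) list \<Rightarrow> complex \<Rightarrow> complex" where
  "rat_poly xs s = (\<Sum>i<length xs. complex_of_rats (xs ! i) * s ^ i)"

lemma complex_of_rats_dense: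
  assumes "\<epsilon> > 0"
  obtains r where "cmod (complex_of_rats r - c) < \<epsilon>"
proof -
  obtain p where p: "Re c < of_rat p" "of_rat p < Re c + \<epsilon>/2"
    using of_rat_dense[of "Re c" "Re c + \<epsilon>/2"] assms by auto
  obtain q where q: "Im c < of_rat q" "of_rat q < Im c + \<epsilon>/2"
    using of_rat_dense[of "Im c" "Im c + \<epsilon>/2"] assms by auto
  have "cmod (complex_of_rats (p, q) - c) \<le> \<bar>of_rat p - Re c\<bar> + \<bar>of_rat q - Im c\<bar>"
    using cmod_le[of "complex_of_rats (p, q) - c"] by (simp add: complex_of_rats_def)
  also have "\<dots> < \<epsilon>" using p q by simp
  finally show ?thesis using that by blast
qed

lemma complex_of_rats_list_dense:
  assumes "\<epsilon> > 0"
  obtains xs where "length xs = n" "\<And>i. i < n \<Longrightarrow> cmod (complex_of_rats (xs ! i) - c i) < \<epsilon>"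
proof -
  have "\<forall>i. \<exists>r. cmod (complex_of_rats r - c i) < \<epsilon>"
    using complex_of_rats_dense[OF assms] by metis
  then obtain f where f: "\<And>i. cmod (complex_of_rats (f i) - c i) < \<epsilon>" by metis
  show ?thesis by (rule that[of "map f [0..<n]"]) (auto simp: f)
qed

lemma holomorphic_rat_poly: "rat_poly xs holomorphic_on UNIV"
  unfolding rat_poly_def[abs_def] by (intro holomorphic_intros)

lemma jets_close_triangle:
  "jets_close k \<epsilon> f g \<Longrightarrow> jets_close k \<delta> g h \<Longrightarrow> jets_close k (\<epsilon> + \<delta>) f h"
  unfolding jets_close_def by (blast intro: norm_diff_triangle_le)

lemma jets_close_mono:
  "jets_close k \<epsilon> f g \<Longrightarrow> l \<le> k \<Longrightarrow> \<epsilon> \<le> \<delta> \<Longrightarrow> jets_close l \<delta> f g"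
  unfolding jets_close_def by (meson of_nat_mono order_trans)

text \<open>Rational polynomials replace the uncountably many entire targets: approximate a Taylor polynomial
  on a disc of radius \<open>k + 1\<close> coefficientwise; the additional \<open>1\<close> is spent on the derivatives.\<close>

lemma rat_poly_dense:
  assumes g: "g holomorphic_on UNIV" and \<epsilon>: "\<epsilon> > 0"
  obtains xs where "jets_close k \<epsilon> (rat_poly xs) g"
proof -
  define r where "r = real k + 1"
  obtain \<eta> where \<eta>: "\<eta> > 0" and close: "\<And>f g. \<lbrakk>f holomorphic_on UNIV; g holomorphic_on UNIV;
      \<And>s. Re s \<le> 1 \<Longrightarrow> cmod s \<le> real k + 1 \<Longrightarrow> cmod (f s - g s) \<le> \<eta>\<rbrakk> \<Longrightarrow> jets_close k \<epsilon> f g"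
    using jets_close_of_close[of 1 \<epsilon> k] \<epsilon> by (metis zero_less_one)
  obtain p where p: "\<And>z. z \<in> cball 0 r \<Longrightarrow> cmod (poly p z - g z) \<le> \<eta>/2"
    using holomorphic_poly_approx[OF holomorphic_on_subset[OF g subset_UNIV], of r "r + 1" "\<eta>/2" 0] \<eta>
    by auto
  define n where "n = Suc (degree p)"
  have n: "real n > 0" by (simp add: n_def)
  have r: "r \<ge> 1" by (simp add: r_def)
  obtain xs where xs: "length xs = n"
    "\<And>i. i < n \<Longrightarrow> cmod (complex_of_rats (xs ! i) - coeff p i) < \<eta> / (2 * real n * r ^ n)"
    using complex_of_rats_list_dense[of "\<eta> / (2 * real n * r ^ n)" n "coeff p"] \<eta> n r by auto
  have "cmod (rat_poly xs s - g s) \<le> \<eta>" if s: "cmod s \<le> r" for s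
  proof -
    have "rat_poly xs s - poly p s = (\<Sum>i<n. (complex_of_rats (xs ! i) - coeff p i) * s ^ i)"
      unfolding rat_poly_def xs(1) poly_altdef n_def lessThan_Suc_atMost
      by (simp add: sum_subtractf left_diff_distrib)
    also have "cmod \<dots> \<le> (\<Sum>i<n. \<eta> / (2 * real n * r ^ n) * r ^ n)"
    proof (rule sum_norm_le)
      fix i assume i: "i \<in> {..<n}"
      have "cmod s ^ i \<le> r ^ i" using s by (intro power_mono) auto
      also have "\<dots> \<le> r ^ n" using i r by (intro power_increasing) auto
      finally show "cmod ((complex_of_rats (xs ! i) - coeff p i) * s ^ i) \<le> \<eta> / (2 * real n * r ^ n) * r ^ n"
        unfolding norm_mult norm_power using xs(2)[of i] i \<eta> n r by (intro mult_mono) auto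
    qed
    also have "\<dots> = \<eta>/2" using n r by simp
    finally have "cmod (rat_poly xs s - poly p s) \<le> \<eta>/2" .
    then show ?thesis
      using p[of s] s norm_triangle_ineq[of "rat_poly xs s - poly p s" "poly p s - g s"] by simp
  qed
  then show ?thesis
    by (intro that close holomorphic_rat_poly g) (simp add: r_def)
qed

lemma jets_close_compact_halfplane:
  assumes "jets_close k \<epsilon> f g" "l \<le> k" "K \<subseteq> {s. Re s \<le> 0}" "\<And>s. s \<in> K \<Longrightarrow> cmod s \<le> real k" "s \<in> K"
  shows "dist ((deriv ^^ l) f s) ((deriv ^^ l) g s) \<le> \<epsilon>"
  using assms unfolding jets_close_def dist_norm by blast

text \<open>A diagonal choice: \<open>L k\<close> is a length that works on the half disc of radius \<open>k\<close>, for derivatives up to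
  order \<open>k\<close>, and with error \<open>1 / (k + 1)\<close>.\<close>

lemma universal_dirichletI:
  assumes "\<And>g k. g holomorphic_on UNIV \<Longrightarrow>
    \<exists>N>0. jets_close k (1 / (real k + 1)) (dirichlet_partial_sum a N) g"
  shows "universal_dirichlet a"
  unfolding universal_dirichlet_def
proof (intro allI impI)
  fix g :: "complex \<Rightarrow> complex" assume "g holomorphic_on UNIV"
  then have "\<forall>k. \<exists>N>0. jets_close k (1 / (real k + 1)) (dirichlet_partial_sum a N) g"
    using assms by blast
  then obtain L where L: "\<And>k. L k > 0"
    "\<And>k. jets_close k (1 / (real k + 1)) (dirichlet_partial_sum a (L k)) g"
    by metis
  show "\<exists>L. (\<forall>n. 0 < L n) \<and> (\<forall>l K. compact K \<and> K \<subseteq> {s. Re s \<le> 0} \<longrightarrow>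
      uniform_limit K (\<lambda>n. (deriv ^^ l) (dirichlet_partial_sum a (L n))) ((deriv ^^ l) g) sequentially)"
  proof (intro exI[of _ L] conjI allI impI)
    fix l and K :: "complex set" assume K: "compact K \<and> K \<subseteq> {s. Re s \<le> 0}"
    obtain B where B: "\<And>s. s \<in> K \<Longrightarrow> cmod s \<le> B"
      using compact_imp_bounded[OF conjunct1[OF K]] unfolding bounded_iff by blast
    show "uniform_limit K (\<lambda>n. (deriv ^^ l) (dirichlet_partial_sum a (L n))) ((deriv ^^ l) g) sequentially"
    proof (rule uniform_limitI)
      fix e :: real assume e: "e > 0"
      have "\<forall>\<^sub>F k in sequentially. B \<le> real k" "\<forall>\<^sub>F k in sequentially. 1 / e \<le> real k"
        "\<forall>\<^sub>F k in sequentially. l \<le> k"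
        using filterlim_real_sequentially eventually_ge_at_top
        by (auto simp: filterlim_at_top)
      then show "\<forall>\<^sub>F n in sequentially. \<forall>s\<in>K.
          dist ((deriv ^^ l) (dirichlet_partial_sum a (L n)) s) ((deriv ^^ l) g s) < e"
      proof eventually_elim
        case (elim k)
        have "1 / (real k + 1) < e" using elim(2) e by (simp add: field_simps)
        moreover have "dist ((deriv ^^ l) (dirichlet_partial_sum a (L k)) s) ((deriv ^^ l) g s)
            \<le> 1 / (real k + 1)" if "s \<in> K" for s
        proof (rule jets_close_compact_halfplane[OF L(2) elim(3) _ _ that])
          show "K \<subseteq> {s. Re s \<le> 0}" using K by blast
          show "cmod s \<le> real k" if "s \<in> K" for s using B[OF that] elim(1) by linarith
        qed
        ultimately show ?case by fastforce
      qed
    qed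
  qed (use L in auto)
qed

lemma universal_dirichletD:
  assumes a: "universal_dirichlet a" and g: "g holomorphic_on UNIV" and \<epsilon>: "\<epsilon> > 0"
  shows "\<exists>N>0. jets_close k \<epsilon> (dirichlet_partial_sum a N) g"
proof -
  define K where "K = {s. Re s \<le> 0} \<inter> cball 0 (real k)"
  have K: "compact K" "K \<subseteq> {s. Re s \<le> 0}"
    unfolding K_def by (auto intro!: closed_Int_compact closed_halfspace_Re_le)
  obtain L :: "nat \<Rightarrow> nat" where L: "\<And>n. L n > 0" and
    lim: "\<And>l. uniform_limit K (\<lambda>n. (deriv ^^ l) (dirichlet_partial_sum a (L n))) ((deriv ^^ l) g) sequentially"
    using a g K unfolding universal_dirichlet_def by metis
  have "\<forall>\<^sub>F n in sequentially. \<forall>l\<in>{..k}. \<forall>s\<in>K.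
      dist ((deriv ^^ l) (dirichlet_partial_sum a (L n)) s) ((deriv ^^ l) g s) < \<epsilon>"
    by (intro eventually_ball_finite ballI uniform_limitD[OF lim \<epsilon>]) auto
  then obtain n where "\<forall>l\<in>{..k}. \<forall>s\<in>K.
      dist ((deriv ^^ l) (dirichlet_partial_sum a (L n)) s) ((deriv ^^ l) g s) < \<epsilon>"
    unfolding eventually_sequentially by blast
  then have "jets_close k \<epsilon> (dirichlet_partial_sum a (L n)) g"
    unfolding jets_close_def K_def dist_norm by (auto intro: less_imp_le)
  then show ?thesis using L by blast
qed

text \<open>The strict inequality \<open>\<delta> < 1 / (k + 1)\<close> leaves the room that makes the condition open.\<close>

definition rat_poly_approximants :: "(rat \<times> rat) list \<Rightarrow> nat \<Rightarrow> (nat \<Rightarrow> complex) set" where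
  "rat_poly_approximants xs k = {a \<in> abs_conv_dirichlet.
     \<exists>N>0. \<exists>\<delta><1 / (real k + 1). jets_close k \<delta> (dirichlet_partial_sum a N) (rat_poly xs)}"

lemma universal_dirichlet_eq_Inter:
  "{a \<in> abs_conv_dirichlet. universal_dirichlet a} = (\<Inter>(xs, k). rat_poly_approximants xs k)"
proof (intro equalityI subsetI)
  fix a assume a: "a \<in> {a \<in> abs_conv_dirichlet. universal_dirichlet a}"
  have "a \<in> rat_poly_approximants xs k" for xs k
  proof -
    have "1 / (2 * (real k + 1)) > 0" by simp
    then obtain N where "N > 0" "jets_close k (1 / (2 * (real k + 1))) (dirichlet_partial_sum a N) (rat_poly xs)"
      using universal_dirichletD[OF _ holomorphic_rat_poly] a by blast
    moreover have "1 / (2 * (real k + 1)) < 1 / (real k + 1)" by (simp add: field_simps)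
    ultimately show ?thesis using a unfolding rat_poly_approximants_def by blast
  qed
  then show "a \<in> (\<Inter>(xs, k). rat_poly_approximants xs k)" by auto
next
  fix a assume "a \<in> (\<Inter>(xs, k). rat_poly_approximants xs k)"
  then have a: "a \<in> rat_poly_approximants xs k" for xs k by auto
  have "universal_dirichlet a"
  proof (rule universal_dirichletI)
    fix g :: "complex \<Rightarrow> complex" and k :: nat assume g: "g holomorphic_on UNIV"
    \<comment> \<open>With this \<open>m\<close>, two errors of size \<open>1 / (m + 1)\<close> add up to \<open>1 / (k + 1)\<close>.\<close>
    define m where "m = 2 * k + 1"
    define e where "e = 1 / (real m + 1)"
    have "e > 0" by (simp add: e_def)
    then obtain xs where xs: "jets_close m e (rat_poly xs) g" using rat_poly_dense[OF g] by blast
    obtain N \<delta> where N: "N > 0" "\<delta> < e" "jets_close m \<delta> (dirichlet_partial_sum a N) (rat_poly xs)"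
      using a[of xs m] unfolding rat_poly_approximants_def e_def by blast
    have close: "jets_close m (\<delta> + e) (dirichlet_partial_sum a N) g"
      using jets_close_triangle[OF N(3) xs] .
    have le: "\<delta> + e \<le> 1 / (real k + 1)"
    proof -
      have "\<delta> + e \<le> 2 * e" using N by simp
      also have "\<dots> = 1 / (real k + 1)" by (simp add: e_def m_def field_simps)
      finally show ?thesis .
    qed
    have "jets_close k (1 / (real k + 1)) (dirichlet_partial_sum a N) g"
      by (rule jets_close_mono[OF close _ le]) (simp add: m_def)
    then show "\<exists>N>0. jets_close k (1 / (real k + 1)) (dirichlet_partial_sum a N) g" using N by blast
  qed
  then show "a \<in> {a \<in> abs_conv_dirichlet. universal_dirichlet a}"
    using a[of "[]" 0] by (simp add: rat_poly_approximants_def)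
qed

text \<open>A partial sum involves finitely many coefficients, and each of them is controlled by any one of the
  semi-norms.\<close>

lemma dirichlet_partial_sum_jets_continuous:
  assumes \<epsilon>: "\<epsilon> > 0"
  obtains \<delta> where "\<delta> > 0" and "\<And>a b. \<lbrakk>a \<in> abs_conv_dirichlet; b \<in> abs_conv_dirichlet;
      dirichlet_seminorm 1 (b - a) < \<delta>\<rbrakk> \<Longrightarrow>
      jets_close k \<epsilon> (dirichlet_partial_sum b N) (dirichlet_partial_sum a N)"
proof -
  obtain \<eta> where \<eta>: "\<eta> > 0" and close: "\<And>f g. \<lbrakk>f holomorphic_on UNIV; g holomorphic_on UNIV;
      \<And>s. Re s \<le> 1 \<Longrightarrow> cmod s \<le> real k + 1 \<Longrightarrow> cmod (f s - g s) \<le> \<eta>\<rbrakk> \<Longrightarrow> jets_close k \<epsilon> f g"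
    using jets_close_of_close[of 1 \<epsilon> k] \<epsilon> by (metis zero_less_one)
  define C where "C = real N powr (real k + 2) + 1"
  have C: "C > 0" unfolding C_def by (intro add_nonneg_pos) auto
  show ?thesis
  proof (rule that[of "\<eta> / C"])
    show "\<eta> / C > 0" using \<eta> C by simp
  next
    fix a b assume ab: "a \<in> abs_conv_dirichlet" "b \<in> abs_conv_dirichlet"
      and lt: "dirichlet_seminorm 1 (b - a) < \<eta> / C"
    show "jets_close k \<epsilon> (dirichlet_partial_sum b N) (dirichlet_partial_sum a N)"
    proof (intro close holomorphic_dirichlet_partial_sum)
      fix s assume s: "cmod s \<le> real k + 1"
      have "dirichlet_partial_sum b N s - dirichlet_partial_sum a N s
          = (\<Sum>n=1..N. (b - a) n * of_nat n powr (-s))"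
        by (simp add: dirichlet_partial_sum_def sum_subtractf left_diff_distrib)
      also have "cmod \<dots> \<le> (\<Sum>n=1..N. C * (cmod ((b - a) n) * real n powr (-1)))"
      proof (rule sum_norm_le)
        fix n assume n: "n \<in> {1..N}"
        have "cmod (of_nat n powr (-s)) = real n powr (- Re s)"
          using norm_powr_real_powr[of "of_nat n" "-s"] by simp
        also have "\<dots> \<le> real n powr (real k + 1)"
          using n s abs_Re_le_cmod[of s] by (intro powr_mono) auto
        also have "\<dots> = real n powr (real k + 2) * real n powr (-1)"
          by (simp only: powr_add[symmetric]) (simp add: add.commute)
        also have "\<dots> \<le> C * real n powr (-1)"
          using n powr_mono2[of "real k + 2" "real n" "real N"]
          by (intro mult_right_mono) (auto simp: C_def)
        finally have "cmod (of_nat n powr (-s)) \<le> C * real n powr (-1)" .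
        then show "cmod ((b - a) n * of_nat n powr (-s)) \<le> C * (cmod ((b - a) n) * real n powr (-1))"
          unfolding norm_mult using mult_left_mono[OF _ norm_ge_zero[of "(b - a) n"]]
          by (simp only: mult.left_commute[of C])
      qed
      also have "\<dots> \<le> C * dirichlet_seminorm 1 (b - a)"
        unfolding sum_distrib_left[symmetric] using ab C
        by (intro mult_left_mono sum_le_dirichlet_seminorm abs_conv_dirichlet_diff) auto
      also have "\<dots> \<le> C * (\<eta> / C)" using lt C by (intro mult_left_mono) auto
      also have "\<dots> = \<eta>" using C by simp
      finally show "cmod (dirichlet_partial_sum b N s - dirichlet_partial_sum a N s) \<le> \<eta>" .
    qed
  qed
qed

lemma openin_rat_poly_approximants:
  "openin abs_conv_dirichlet_topology (rat_poly_approximants xs k)"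
  unfolding openin_abs_conv_dirichlet_topology
proof (intro conjI ballI)
  show "rat_poly_approximants xs k \<subseteq> abs_conv_dirichlet" by (auto simp: rat_poly_approximants_def)
  fix a assume "a \<in> rat_poly_approximants xs k"
  then obtain N \<delta> where a: "a \<in> abs_conv_dirichlet" "N > 0" "\<delta> < 1 / (real k + 1)"
    "jets_close k \<delta> (dirichlet_partial_sum a N) (rat_poly xs)"
    unfolding rat_poly_approximants_def by blast
  define A where "A = 1 / (real k + 1)"
  define e where "e = (A - \<delta>) / 2"
  have "\<delta> < A" using a(3) by (simp add: A_def)
  then have e: "e > 0" "e + \<delta> < 1 / (real k + 1)"
    unfolding A_def[symmetric] e_def by (auto simp: field_simps)
  obtain \<eta> where \<eta>: "\<eta> > 0" "\<And>b. \<lbrakk>b \<in> abs_conv_dirichlet; dirichlet_seminorm 1 (b - a) < \<eta>\<rbrakk> \<Longrightarrow>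
      jets_close k e (dirichlet_partial_sum b N) (dirichlet_partial_sum a N)"
    using dirichlet_partial_sum_jets_continuous[OF e(1), of k N] a(1) by metis
  have "b \<in> rat_poly_approximants xs k"
    if "b \<in> abs_conv_dirichlet" "dirichlet_seminorm 1 (b - a) < \<eta>" for b
    using jets_close_triangle[OF \<eta>(2)[OF that] a(4)] a(2) e(2) that(1)
    unfolding rat_poly_approximants_def by blast
  then show "\<exists>\<sigma>>0. \<exists>\<epsilon>>0. \<forall>b\<in>abs_conv_dirichlet. dirichlet_seminorm \<sigma> (b - a) < \<epsilon> \<longrightarrow>
      b \<in> rat_poly_approximants xs k"
    using \<eta>(1) zero_less_one by blast
qed

lemma gdelta_in_universal_dirichlet:
  "gdelta_in abs_conv_dirichlet_topology {a \<in> abs_conv_dirichlet. universal_dirichlet a}"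
proof -
  have "countable (range (\<lambda>(xs, k). rat_poly_approximants xs k))" by simp
  then show ?thesis
    unfolding universal_dirichlet_eq_Inter
    by (intro gdelta_in_Inter) (auto intro: open_imp_gdelta_in openin_rat_poly_approximants)
qed

section \<open>A sequence of series with independently prescribed partial sums\<close>

lemma dirichlet_partial_sum_extend:
  assumes "\<And>n. a n \<noteq> 0 \<Longrightarrow> n \<le> M" "M \<le> N"
  shows "dirichlet_partial_sum a N = dirichlet_partial_sum a M"
  unfolding dirichlet_partial_sum_def
proof (rule ext)
  fix s
  show "(\<Sum>n=1..N. a n * of_nat n powr (-s)) = (\<Sum>n=1..M. a n * of_nat n powr (-s))"
    using assms by (intro sum.mono_neutral_right) force+
qed

lemma dirichlet_partial_sum_cong:
  "(\<And>n. n \<le> N \<Longrightarrow> a n = b n) \<Longrightarrow> dirichlet_partial_sum a N = dirichlet_partial_sum b N"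
  unfolding dirichlet_partial_sum_def by (intro ext sum.cong) auto

lemma jets_close_shift:
  assumes f: "f holomorphic_on UNIV" and g: "g holomorphic_on UNIV" and h: "h holomorphic_on UNIV"
    and "jets_close k \<epsilon> h (\<lambda>s. g s - f s)"
  shows "jets_close k \<epsilon> (\<lambda>s. f s + h s) g"
proof -
  have "(deriv ^^ l) (\<lambda>s. f s + h s) s - (deriv ^^ l) g s
      = (deriv ^^ l) h s - (deriv ^^ l) (\<lambda>s. g s - f s) s" for l s
    using higher_deriv_add[OF f h open_UNIV, of s l] higher_deriv_diff[OF g f open_UNIV, of s l]
    by simp
  then show ?thesis using assms(4) unfolding jets_close_def by simp
qed

text \<open>One stage of the construction. The family \<open>A\<close> holds the current Dirichlet polynomials, of which those
  with index at most \<open>t\<close> have been extended up to length \<open>N\<close>. Each of these receives a block beyond \<open>N\<close>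
  that corrects the difference to its target, and \<open>N'\<close> is a common length that covers all blocks.
  The bound \<open>L\<close> is there to cover a polynomial that joins at the next stage.\<close>

lemma dirichlet_stage:
  fixes A :: "nat \<Rightarrow> nat \<Rightarrow> complex"
  assumes supp: "\<And>m n. m \<le> t \<Longrightarrow> A m n \<noteq> 0 \<Longrightarrow> n \<le> N"
    and \<sigma>: "\<sigma> > 0" and \<epsilon>: "\<epsilon> > 0" and G: "\<And>m. G m holomorphic_on UNIV"
  obtains A' N' where "N < N'" "L \<le> N'" "\<forall>m>t. A' m = A m"
    and "\<forall>m\<le>t. \<forall>n\<le>N. A' m n = A m n"
    and "\<forall>m\<le>t. \<forall>n. A' m n \<noteq> 0 \<longrightarrow> n \<le> N'"
    and "\<forall>m\<le>t. \<forall>M. (\<Sum>n=1..M. cmod (A' m n - A m n) * real n powr (-\<sigma>)) \<le> \<epsilon>"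
    and "\<forall>m\<le>t. jets_close k \<epsilon> (dirichlet_partial_sum (A' m) N') (G m)"
proof -
  have "\<forall>m. \<exists>h M. (\<forall>n. h n \<noteq> 0 \<longrightarrow> N < n \<and> n \<le> M) \<and>
      (\<Sum>n=1..M. cmod (h n) * real n powr (-\<sigma>)) \<le> \<epsilon> \<and>
      jets_close k \<epsilon> (dirichlet_partial_sum h M) (\<lambda>s. G m s - dirichlet_partial_sum (A m) N s)"
    by (intro allI dirichlet_block \<sigma> \<epsilon> holomorphic_on_diff G holomorphic_dirichlet_partial_sum)
  from choice[OF this] obtain h where "\<forall>m. \<exists>M. (\<forall>n. h m n \<noteq> 0 \<longrightarrow> N < n \<and> n \<le> M) \<and>
      (\<Sum>n=1..M. cmod (h m n) * real n powr (-\<sigma>)) \<le> \<epsilon> \<and>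
      jets_close k \<epsilon> (dirichlet_partial_sum (h m) M) (\<lambda>s. G m s - dirichlet_partial_sum (A m) N s)" ..
  from choice[OF this] obtain M where hM: "\<forall>m. (\<forall>n. h m n \<noteq> 0 \<longrightarrow> N < n \<and> n \<le> M m) \<and>
      (\<Sum>n=1..M m. cmod (h m n) * real n powr (-\<sigma>)) \<le> \<epsilon> \<and>
      jets_close k \<epsilon> (dirichlet_partial_sum (h m) (M m))
        (\<lambda>s. G m s - dirichlet_partial_sum (A m) N s)" ..
  then have h: "\<And>m n. h m n \<noteq> 0 \<Longrightarrow> N < n \<and> n \<le> M m"
    and h_sum: "\<And>m. (\<Sum>n=1..M m. cmod (h m n) * real n powr (-\<sigma>)) \<le> \<epsilon>"
    and h_jets: "\<And>m. jets_close k \<epsilon> (dirichlet_partial_sum (h m) (M m))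
      (\<lambda>s. G m s - dirichlet_partial_sum (A m) N s)"
    by simp_all
  define N' where "N' = Max ({Suc N, L} \<union> M ` {..t})"
  have N'_ge: "x \<le> N'" if "x \<in> {Suc N, L} \<union> M ` {..t}" for x
    unfolding N'_def using that by (intro Max_ge) auto
  have N': "N < N'" "L \<le> N'" using N'_ge[of "Suc N"] N'_ge[of L] by auto
  have M: "M m \<le> N'" if "m \<le> t" for m using that by (intro N'_ge) auto
  define A' where "A' m = (if m \<le> t then \<lambda>n. A m n + h m n else A m)" for m
  show ?thesis
  proof (rule that[of N' A'])
    show "N < N'" "L \<le> N'" by (fact N')+
    show "\<forall>m>t. A' m = A m" by (simp add: A'_def)
    show "\<forall>m\<le>t. \<forall>n\<le>N. A' m n = A m n" using h by (force simp: A'_def)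
  next
    show "\<forall>m\<le>t. \<forall>n. A' m n \<noteq> 0 \<longrightarrow> n \<le> N'"
    proof (intro allI impI)
      fix m n assume m: "m \<le> t" and that: "A' m n \<noteq> 0"
      show "n \<le> N'"
      proof (cases "A m n = 0")
        case True
        then show ?thesis using h[of m n] that m M[OF m] by (auto simp: A'_def)
      next
        case False
        then show ?thesis using supp[OF m] N'(1) by fastforce
      qed
    qed
  next
    show "\<forall>m\<le>t. \<forall>M. (\<Sum>n=1..M. cmod (A' m n - A m n) * real n powr (-\<sigma>)) \<le> \<epsilon>"
    proof (intro allI impI)
      fix m R assume m: "m \<le> t"
      show "(\<Sum>n=1..R. cmod (A' m n - A m n) * real n powr (-\<sigma>)) \<le> \<epsilon>"
      proof -
        have "(\<Sum>n=1..R. cmod (A' m n - A m n) * real n powr (-\<sigma>))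
            = (\<Sum>n\<in>{1..R} \<inter> {1..M m}. cmod (h m n) * real n powr (-\<sigma>))"
          using m h[of m] by (intro sum.mono_neutral_cong_right) (force simp: A'_def)+
        also have "\<dots> \<le> (\<Sum>n=1..M m. cmod (h m n) * real n powr (-\<sigma>))"
          by (intro sum_mono2) auto
        finally show ?thesis using h_sum[of m] by simp
      qed
    qed
  next
    show "\<forall>m\<le>t. jets_close k \<epsilon> (dirichlet_partial_sum (A' m) N') (G m)"
    proof (intro allI impI)
      fix m assume m: "m \<le> t"
      have "dirichlet_partial_sum (A' m) N' s
          = dirichlet_partial_sum (A m) N s + dirichlet_partial_sum (h m) (M m) s" for s
      proof -
        have "dirichlet_partial_sum (A' m) N' s
            = dirichlet_partial_sum (A m) N' s + dirichlet_partial_sum (h m) N' s"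
          using m by (simp add: dirichlet_partial_sum_def A'_def distrib_right sum.distrib)
        moreover have "dirichlet_partial_sum (A m) N' = dirichlet_partial_sum (A m) N"
          using supp[OF m] N'(1) by (intro dirichlet_partial_sum_extend) auto
        moreover have "dirichlet_partial_sum (h m) N' = dirichlet_partial_sum (h m) (M m)"
          using h M[OF m] by (intro dirichlet_partial_sum_extend) auto
        ultimately show ?thesis by simp
      qed
      then have "dirichlet_partial_sum (A' m) N'
          = (\<lambda>s. dirichlet_partial_sum (A m) N s + dirichlet_partial_sum (h m) (M m) s)" by blast
      then show "jets_close k \<epsilon> (dirichlet_partial_sum (A' m) N') (G m)"
        using jets_close_shift[OF holomorphic_dirichlet_partial_sum G holomorphic_dirichlet_partial_sum h_jets]
        by simp
    qed
  qed
qed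

lemma finite_support_abs_conv_dirichlet:
  assumes "a 0 = 0" "\<And>n. a n \<noteq> 0 \<Longrightarrow> n \<le> N"
  shows "a \<in> abs_conv_dirichlet"
  unfolding abs_conv_dirichlet_def
proof (intro CollectI conjI allI impI)
  fix \<sigma> :: real
  show "summable (\<lambda>n. cmod (a n) * real n powr (-\<sigma>))"
    using assms(2) by (intro summable_finite[of "{..N}"]) auto
qed (fact assms(1))

text \<open>The series with index \<open>m\<close> starts as \<open>p m\<close> and takes part in the stages \<open>t \<ge> m\<close>. The block of stage \<open>t\<close>
  has size at most \<open>(1/2) ^ t\<close> in the semi-norm \<open>1 / (t + 1)\<close>. Every semi-norm is dominated by these
  from some \<open>t\<close> on, so the blocks are summable in each of them, and the total change of \<open>p m\<close> is at
  most \<open>2 * (1/2) ^ m\<close> in the semi-norm \<open>1 / (m + 1)\<close>.\<close>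

lemma dirichlet_sequence_with_prescribed_partial_sums:
  fixes p :: "nat \<Rightarrow> nat \<Rightarrow> complex" and G :: "nat \<Rightarrow> nat \<Rightarrow> complex \<Rightarrow> complex"
  assumes p0: "\<And>m. p m 0 = 0" and p_supp: "\<And>m n. p m n \<noteq> 0 \<Longrightarrow> n \<le> S m"
    and G: "\<And>t m. G t m holomorphic_on UNIV"
  obtains a N where "\<And>m. a m \<in> abs_conv_dirichlet"
    and "\<And>m. dirichlet_seminorm (1 / (real m + 1)) (a m - p m) \<le> 2 * (1/2) ^ m"
    and "\<And>t. N t > 0"
    and "\<And>m t. m \<le> t \<Longrightarrow> jets_close t (1 / (real t + 1)) (dirichlet_partial_sum (a m) (N t)) (G t m)"
proof -
  \<comment> \<open>The state \<open>X\<close> before stage \<open>t\<close> consists of the family and the current length.\<close>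
  define P where "P t X \<longleftrightarrow> t \<le> snd X \<and> (\<forall>m\<ge>t. fst X m = p m) \<and> (\<forall>m. fst X m 0 = 0) \<and>
      (\<forall>m\<le>t. \<forall>n. fst X m n \<noteq> 0 \<longrightarrow> n \<le> snd X)" for t and X :: "(nat \<Rightarrow> nat \<Rightarrow> complex) \<times> nat"
  define Q where "Q t X Y \<longleftrightarrow> snd X < snd Y \<and> (\<forall>m\<le>t. (\<forall>n\<le>snd X. fst Y m n = fst X m n) \<and>
      (\<forall>M. (\<Sum>n=1..M. cmod (fst Y m n - fst X m n) * real n powr (- (1 / (real t + 1)))) \<le> (1/2) ^ t) \<and>
      jets_close t (1 / (real t + 1)) (dirichlet_partial_sum (fst Y m) (snd Y)) (G t m))"
    for t and X Y :: "(nat \<Rightarrow> nat \<Rightarrow> complex) \<times> nat"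
  have "\<exists>f. \<forall>t. P t (f t) \<and> Q t (f t) (f (Suc t))"
  proof (rule dependent_nat_choice)
    have "P 0 (p, S 0)" using p0 p_supp by (simp add: P_def)
    then show "\<exists>X. P 0 X" ..
  next
    fix X t assume "P t X"
    then obtain A N where X: "X = (A, N)" and tN: "t \<le> N" and A_eq: "\<And>m. t \<le> m \<Longrightarrow> A m = p m"
      and A0: "\<And>m. A m 0 = 0" and supp: "\<And>m n. m \<le> t \<Longrightarrow> A m n \<noteq> 0 \<Longrightarrow> n \<le> N"
      unfolding P_def by (cases X) auto
    define \<epsilon> where "\<epsilon> = min ((1/2) ^ t) (1 / (real t + 1))"
    have \<epsilon>: "\<epsilon> > 0" and \<sigma>: "1 / (real t + 1) > 0" by (auto simp: \<epsilon>_def)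
    obtain A' N' where A': "N < N'" "S (Suc t) \<le> N'" "\<forall>m>t. A' m = A m"
      "\<forall>m\<le>t. \<forall>n\<le>N. A' m n = A m n"
      "\<forall>m\<le>t. \<forall>n. A' m n \<noteq> 0 \<longrightarrow> n \<le> N'"
      "\<forall>m\<le>t. \<forall>M. (\<Sum>n=1..M. cmod (A' m n - A m n) * real n powr (- (1 / (real t + 1)))) \<le> \<epsilon>"
      "\<forall>m\<le>t. jets_close t \<epsilon> (dirichlet_partial_sum (A' m) N') (G t m)"
      by (rule dirichlet_stage[where G = "G t" and k = t and L = "S (Suc t)", OF supp \<sigma> \<epsilon> G],
          assumption, assumption) (rule that; assumption)
    note A' = A'[rule_format]
    have "P (Suc t) (A', N')"
      unfolding P_def fst_conv snd_conv
    proof (intro conjI allI impI)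
      show "Suc t \<le> N'" using tN A'(1) by simp
      show "A' m = p m" if "Suc t \<le> m" for m using A'(3)[of m] A_eq[of m] that by simp
      show "A' m 0 = 0" for m using A'(3,4)[of m] A0[of m] by (cases "m \<le> t") auto
      show "n \<le> N'" if "m \<le> Suc t" "A' m n \<noteq> 0" for m n
      proof (cases "m \<le> t")
        case False
        then have "m = Suc t" using that(1) by simp
        then show ?thesis using that(2) A'(2) A'(3)[of m] A_eq[of m] p_supp[of m n] by auto
      qed (use A'(5) that in blast)
    qed
    moreover have "Q t X (A', N')"
      unfolding Q_def X fst_conv snd_conv
    proof (intro conjI allI impI)
      fix m assume m: "m \<le> t"
      show "A' m n = A m n" if "n \<le> N" for n using A'(4)[OF m that] .
      show "(\<Sum>n=1..M. cmod (A' m n - A m n) * real n powr (- (1 / (real t + 1)))) \<le> (1/2) ^ t" for M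
        using A'(6)[OF m, of M] by (simp add: \<epsilon>_def)
      show "jets_close t (1 / (real t + 1)) (dirichlet_partial_sum (A' m) N') (G t m)"
        using A'(7)[OF m] by (rule jets_close_mono) (simp_all add: \<epsilon>_def)
    qed (fact A'(1))
    ultimately show "\<exists>Y. P (Suc t) Y \<and> Q t X Y" by blast
  qed
  then obtain f where f: "\<And>t. P t (f t)" "\<And>t. Q t (f t) (f (Suc t))" by blast
  define B where "B t = fst (f t)" for t
  define N where "N t = snd (f t)" for t
  have N_ge: "t \<le> N t" and B_p: "B t t = p t" and B0: "B t m 0 = 0" for t m
    using f(1)[of t] by (auto simp: P_def B_def N_def)
  have B_supp: "n \<le> N t" if "m \<le> t" "B t m n \<noteq> 0" for t m n
    using f(1)[of t] that by (auto simp: P_def B_def N_def)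
  have N_less: "N t < N (Suc t)" for t using f(2)[of t] by (simp add: Q_def N_def)
  have B_step: "B (Suc t) m n = B t m n" if "m \<le> t" "n \<le> N t" for t m n
    using f(2)[of t] that by (simp add: Q_def N_def B_def)
  have B_sum: "(\<Sum>n=1..M. cmod (B (Suc t) m n - B t m n) * real n powr (- (1 / (real t + 1)))) \<le> (1/2) ^ t"
    if "m \<le> t" for t m M
    using f(2)[of t] that by (simp add: Q_def N_def B_def)
  have B_jets: "jets_close t (1 / (real t + 1)) (dirichlet_partial_sum (B (Suc t) m) (N (Suc t))) (G t m)"
    if "m \<le> t" for t m
    using f(2)[of t] that by (simp add: Q_def N_def B_def)
  have N_mono: "N t \<le> N t'" if "t \<le> t'" for t t'
    by (rule lift_Suc_mono_le[of N, OF less_imp_le[OF N_less] that])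
  have B_const: "B t' m n = B t m n" if "m \<le> t" "n \<le> N t" "t \<le> t'" for t t' m n
    using that(3)
  proof (induction t' rule: dec_induct)
    case (step t')
    have "n \<le> N t'" using that(2) N_mono[OF step(1)] by simp
    then show ?case using B_step[of m t' n] that(1) step by simp
  qed simp
  \<comment> \<open>Stage \<open>max m n\<close> has settled the coefficient with index \<open>n\<close> of the \<open>m\<close>-th series.\<close>
  define a where "a m n = B (max m n) m n" for m n
  have a_eq: "a m n = B t m n" if "m \<le> t" "n \<le> N t" for t m n
  proof -
    have "n \<le> N (max m n)" using N_ge[of "max m n"] by simp
    then have "B (max t (max m n)) m n = B (max m n) m n" by (intro B_const) auto
    moreover have "B (max t (max m n)) m n = B t m n" using that by (intro B_const) auto
    ultimately show ?thesis by (simp add: a_def)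
  qed
  have a0: "a m 0 = 0" for m by (simp add: a_def B0)
  have tail: "(\<Sum>n=1..M. cmod (a m n - B t m n) * real n powr (-\<sigma>)) \<le> 2 * (1/2) ^ t"
    if m: "m \<le> t" and \<sigma>: "1 / (real t + 1) \<le> \<sigma>" for m t M \<sigma>
  proof -
    define D where "D T = (\<Sum>n=1..M. cmod (B T m n - B t m n) * real n powr (-\<sigma>))" for T
    \<comment> \<open>The right-hand side is the sum of \<open>(1/2) ^ i\<close> over \<open>t \<le> i < T\<close>.\<close>
    have "D T \<le> 2 * (1/2) ^ t - 2 * (1/2) ^ T" if "t \<le> T" for T
      using that
    proof (induction T rule: dec_induct)
      case (step T)
      have "D (Suc T) \<le> (\<Sum>n=1..M. cmod (B (Suc T) m n - B T m n) * real n powr (- (1 / (real T + 1)))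
          + cmod (B T m n - B t m n) * real n powr (-\<sigma>))"
        unfolding D_def
      proof (rule sum_mono)
        fix n assume n: "n \<in> {1..M}"
        have "1 / (real T + 1) \<le> 1 / (real t + 1)" using step(1) by (intro divide_left_mono) auto
        then have w: "real n powr (-\<sigma>) \<le> real n powr (- (1 / (real T + 1)))"
          using n \<sigma> by (intro powr_mono) auto
        have "cmod (B (Suc T) m n - B t m n) * real n powr (-\<sigma>)
            \<le> (cmod (B (Suc T) m n - B T m n) + cmod (B T m n - B t m n)) * real n powr (-\<sigma>)"
          using norm_triangle_ineq[of "B (Suc T) m n - B T m n" "B T m n - B t m n"]
          by (intro mult_right_mono) auto
        also have "\<dots> \<le> cmod (B (Suc T) m n - B T m n) * real n powr (- (1 / (real T + 1)))
            + cmod (B T m n - B t m n) * real n powr (-\<sigma>)"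
          unfolding distrib_right by (intro add_right_mono mult_left_mono w) auto
        finally show "cmod (B (Suc T) m n - B t m n) * real n powr (-\<sigma>)
            \<le> cmod (B (Suc T) m n - B T m n) * real n powr (- (1 / (real T + 1)))
              + cmod (B T m n - B t m n) * real n powr (-\<sigma>)" .
      qed
      also have "\<dots> \<le> (1/2) ^ T + D T"
        using B_sum[of m T M] m step(1) by (simp add: sum.distrib D_def)
      also have "\<dots> \<le> 2 * (1/2) ^ t - 2 * (1/2) ^ Suc T" using step(3) by simp
      finally show ?case .
    qed (simp add: D_def)
    from this[of "max t M"] have "D (max t M) \<le> 2 * (1/2) ^ t - 2 * (1/2) ^ max t M" by simp
    also have "\<dots> \<le> 2 * (1/2) ^ t" by simp
    finally have "D (max t M) \<le> 2 * (1/2) ^ t" .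
    moreover have "a m n = B (max t M) m n" if "n \<in> {1..M}" for n
      using that m N_ge[of "max t M"] by (intro a_eq) auto
    ultimately show ?thesis by (simp add: D_def)
  qed
  have tail': "(\<Sum>n<M. cmod (a m n - B t m n) * real n powr (-\<sigma>)) \<le> 2 * (1/2) ^ t"
    if m: "m \<le> t" and \<sigma>: "1 / (real t + 1) \<le> \<sigma>" for m t M \<sigma>
  proof -
    have "(\<Sum>n<M. cmod (a m n - B t m n) * real n powr (-\<sigma>))
        \<le> (\<Sum>n\<in>insert 0 {1..M}. cmod (a m n - B t m n) * real n powr (-\<sigma>))"
      by (intro sum_mono2) auto
    also have "\<dots> = (\<Sum>n=1..M. cmod (a m n - B t m n) * real n powr (-\<sigma>))" by simp
    finally show ?thesis using tail[OF m \<sigma>, of M] by simp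
  qed
  have summ: "summable (\<lambda>n. cmod (a m n - B t m n) * real n powr (-\<sigma>))"
    if "m \<le> t" "1 / (real t + 1) \<le> \<sigma>" for m t \<sigma>
    by (rule summableI_nonneg_bounded[OF _ tail'[OF that]]) simp
  have a_abs: "a m \<in> abs_conv_dirichlet" for m
    unfolding abs_conv_dirichlet_def
  proof (intro CollectI conjI allI impI a0)
    fix \<sigma> :: real assume \<sigma>: "\<sigma> > 0"
    obtain k :: nat where k: "1 / \<sigma> < real k" using reals_Archimedean2 by blast
    define t where "t = max m k"
    have t: "m \<le> t" "1 / \<sigma> < real t + 1" using k by (auto simp: t_def)
    then have le: "1 / (real t + 1) \<le> \<sigma>" using \<sigma> by (simp add: field_simps)
    have "B t m \<in> abs_conv_dirichlet"
      using B0 B_supp[OF t(1)] by (rule finite_support_abs_conv_dirichlet)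
    then have "summable (\<lambda>n. cmod (a m n - B t m n) * real n powr (-\<sigma>) + cmod (B t m n) * real n powr (-\<sigma>))"
      by (intro summable_add summ[OF t(1) le] abs_conv_dirichlet_summable \<sigma>)
    then show "summable (\<lambda>n. cmod (a m n) * real n powr (-\<sigma>))"
    proof (rule summable_comparison_test')
      fix n
      show "norm (cmod (a m n) * real n powr (-\<sigma>))
          \<le> cmod (a m n - B t m n) * real n powr (-\<sigma>) + cmod (B t m n) * real n powr (-\<sigma>)"
        using mult_right_mono[OF norm_triangle_ineq[of "a m n - B t m n" "B t m n"], of "real n powr (-\<sigma>)"]
        by (simp add: distrib_right)
    qed
  qed
  show ?thesis
  proof (rule that[of a "\<lambda>t. N (Suc t)"])
    show "a m \<in> abs_conv_dirichlet" for m by (rule a_abs)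
    show "dirichlet_seminorm (1 / (real m + 1)) (a m - p m) \<le> 2 * (1/2) ^ m" for m
      unfolding dirichlet_seminorm_def
      using suminf_le_const[OF summ[of m m "1 / (real m + 1)"] tail'[of m m "1 / (real m + 1)"]]
      by (simp add: B_p)
    show "N (Suc t) > 0" for t using N_ge[of "Suc t"] by simp
    fix m t :: nat assume m: "m \<le> t"
    have "dirichlet_partial_sum (a m) (N (Suc t)) = dirichlet_partial_sum (B (Suc t) m) (N (Suc t))"
      using m by (intro dirichlet_partial_sum_cong a_eq) auto
    then show "jets_close t (1 / (real t + 1)) (dirichlet_partial_sum (a m) (N (Suc t))) (G t m)"
      using B_jets[OF m] by simp
  qed
qed

section \<open>A dense subspace of universal series\<close>

definition rat_seq :: "(rat \<times> rat) list \<Rightarrow> nat \<Rightarrow> complex" where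
  "rat_seq xs n = (if 1 \<le> n \<and> n \<le> length xs then complex_of_rats (xs ! (n - 1)) else 0)"

lemma rat_seq_abs_conv_dirichlet: "rat_seq xs \<in> abs_conv_dirichlet"
  by (rule finite_support_abs_conv_dirichlet[of _ "length xs"]) (auto simp: rat_seq_def split: if_splits)

lemma rat_seq_dense:
  assumes a: "a \<in> abs_conv_dirichlet" and \<sigma>: "\<sigma> > 0" and \<epsilon>: "\<epsilon> > 0"
  obtains xs where "dirichlet_seminorm \<sigma> (rat_seq xs - a) < \<epsilon>"
proof -
  have half: "\<epsilon>/2 > 0" using \<epsilon> by simp
  obtain N where N: "norm (\<Sum>i. cmod (a (i + Suc N)) * real (i + Suc N) powr (-\<sigma>)) < \<epsilon>/2"
    using suminf_exist_split[OF half abs_conv_dirichlet_summable[OF a \<sigma>]] le_Suc_eq by blast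
  define \<delta> where "\<delta> = \<epsilon> / (2 * (real N + 1))"
  have "\<delta> > 0" using \<epsilon> by (simp add: \<delta>_def)
  then obtain xs where xs: "length xs = N"
    "\<And>i. i < N \<Longrightarrow> cmod (complex_of_rats (xs ! i) - a (Suc i)) < \<delta>"
    by (rule complex_of_rats_list_dense[of \<delta> N "\<lambda>i. a (Suc i)"]) (rule that)
  define f where "f n = cmod ((rat_seq xs - a) n) * real n powr (-\<sigma>)" for n
  have "summable f"
    unfolding f_def
    by (intro abs_conv_dirichlet_summable abs_conv_dirichlet_diff rat_seq_abs_conv_dirichlet a \<sigma>)
  then have "dirichlet_seminorm \<sigma> (rat_seq xs - a) = (\<Sum>n. f (n + Suc N)) + (\<Sum>n<Suc N. f n)"
    unfolding dirichlet_seminorm_def f_def[symmetric] by (rule suminf_split_initial_segment)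
  moreover have "(\<Sum>n. f (n + Suc N)) = (\<Sum>i. cmod (a (i + Suc N)) * real (i + Suc N) powr (-\<sigma>))"
    by (simp add: f_def rat_seq_def xs(1))
  moreover have "(\<Sum>n<Suc N. f n) \<le> (\<Sum>n<Suc N. \<delta>)"
  proof (rule sum_mono)
    fix n assume n: "n \<in> {..<Suc N}"
    show "f n \<le> \<delta>"
    proof (cases n)
      case 0
      then show ?thesis using \<open>\<delta> > 0\<close> by (simp add: f_def)
    next
      case (Suc i)
      then have "cmod ((rat_seq xs - a) n) \<le> \<delta>" using xs n by (simp add: rat_seq_def less_imp_le)
      moreover have "real n powr (-\<sigma>) \<le> 1"
        using Suc \<sigma> powr_mono[of "-\<sigma>" 0 "real n"] by simp
      ultimately have "f n \<le> \<delta> * 1" unfolding f_def using \<open>\<delta> > 0\<close> by (intro mult_mono) auto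
      then show ?thesis by simp
    qed
  qed
  moreover have "(\<Sum>n<Suc N. \<delta>) = \<epsilon>/2" by (simp add: \<delta>_def field_simps)
  ultimately have "dirichlet_seminorm \<sigma> (rat_seq xs - a) < \<epsilon>" using N by (simp add: abs_less_iff)
  then show ?thesis by (rule that)
qed

lemma higher_deriv_linear_combination:
  assumes "finite I" "\<And>i. i \<in> I \<Longrightarrow> f i holomorphic_on UNIV"
  shows "(deriv ^^ l) (\<lambda>s. \<Sum>i\<in>I. c i * f i s) s = (\<Sum>i\<in>I. c i * (deriv ^^ l) (f i) s)"
  using assms
proof (induction I rule: finite_induct)
  case empty
  then show ?case by simp
next
  case (insert i I)
  have "(deriv ^^ l) (\<lambda>s. c i * f i s + (\<Sum>i\<in>I. c i * f i s)) s
      = (deriv ^^ l) (\<lambda>s. c i * f i s) s + (deriv ^^ l) (\<lambda>s. \<Sum>i\<in>I. c i * f i s) s"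
    using insert.prems by (intro higher_deriv_add[OF _ _ open_UNIV] holomorphic_intros) auto
  moreover have "(deriv ^^ l) (\<lambda>s. c i * f i s) s = c i * (deriv ^^ l) (f i) s"
    using insert.prems by (intro higher_deriv_cmult[OF _ _ open_UNIV]) auto
  ultimately show ?case using insert by simp
qed

lemma jets_close_linear_combination:
  assumes I: "finite I" and f: "\<And>i. i \<in> I \<Longrightarrow> f i holomorphic_on UNIV"
    and g: "\<And>i. i \<in> I \<Longrightarrow> g i holomorphic_on UNIV"
    and close: "\<And>i. i \<in> I \<Longrightarrow> jets_close k \<epsilon> (f i) (g i)"
  shows "jets_close k ((\<Sum>i\<in>I. cmod (c i)) * \<epsilon>) (\<lambda>s. \<Sum>i\<in>I. c i * f i s) (\<lambda>s. \<Sum>i\<in>I. c i * g i s)"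
  unfolding jets_close_def
proof (intro allI impI)
  fix l s assume l: "l \<le> k" and s: "Re s \<le> 0 \<and> cmod s \<le> real k"
  have "(deriv ^^ l) (\<lambda>s. \<Sum>i\<in>I. c i * f i s) s - (deriv ^^ l) (\<lambda>s. \<Sum>i\<in>I. c i * g i s) s
      = (\<Sum>i\<in>I. c i * ((deriv ^^ l) (f i) s - (deriv ^^ l) (g i) s))"
    using higher_deriv_linear_combination[OF I f] higher_deriv_linear_combination[OF I g]
    by (simp add: right_diff_distrib sum_subtractf)
  also have "cmod \<dots> \<le> (\<Sum>i\<in>I. cmod (c i) * \<epsilon>)"
    using close l s unfolding jets_close_def
    by (intro sum_norm_le) (auto simp: norm_mult intro!: mult_left_mono)
  finally show "cmod ((deriv ^^ l) (\<lambda>s. \<Sum>i\<in>I. c i * f i s) s - (deriv ^^ l) (\<lambda>s. \<Sum>i\<in>I. c i * g i s) s)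
      \<le> (\<Sum>i\<in>I. cmod (c i)) * \<epsilon>"
    by (simp add: sum_distrib_right)
qed

text \<open>The linear span of the sequence \<open>a\<close>. Explicit coefficients make it plain that a nonzero element has a
  nonzero coefficient, whether or not the \<open>a i\<close> are independent.\<close>

definition finite_combinations :: "(nat \<Rightarrow> nat \<Rightarrow> complex) \<Rightarrow> (nat \<Rightarrow> complex) set" where
  "finite_combinations a = {v. \<exists>c r. v = (\<lambda>n. \<Sum>i<r. c i * a i n)}"

lemma finite_combinationsI: "(\<lambda>n. \<Sum>i<r. c i * a i n) \<in> finite_combinations a"
  unfolding finite_combinations_def by blast

lemma finite_combinations_member: "a m \<in> finite_combinations a"
proof -
  have "(\<lambda>n. \<Sum>i<Suc m. (if i = m then 1 else 0) * a i n) = a m"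
    by (rule ext) (simp add: if_distrib[of "\<lambda>z. z * _"] cong: if_cong)
  then show ?thesis using finite_combinationsI[where r = "Suc m"] by metis
qed

lemma subspace_finite_combinations: "module.subspace dirichlet_scale (finite_combinations a)"
proof -
  interpret vector_space dirichlet_scale by (rule vector_space_dirichlet_scale)
  have pad: "(\<Sum>i<r. c i * a i n) = (\<Sum>i<R. (if i < r then c i else 0) * a i n)" if "r \<le> R" for c r R n
    using that by (intro sum.mono_neutral_cong_left) auto
  show ?thesis
  proof (rule subspaceI)
    show "0 \<in> finite_combinations a"
      using finite_combinationsI[where r = 0 and a = a] by (simp add: zero_fun_def)
  next
    fix u v assume "u \<in> finite_combinations a" "v \<in> finite_combinations a"
    then obtain c r d q where u: "u = (\<lambda>n. \<Sum>i<r. c i * a i n)" and v: "v = (\<lambda>n. \<Sum>i<q. d i * a i n)"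
      unfolding finite_combinations_def by blast
    define e where "e i = (if i < r then c i else 0) + (if i < q then d i else 0)" for i
    have "u + v = (\<lambda>n. \<Sum>i<max r q. e i * a i n)"
      unfolding u v plus_fun_def e_def
      using pad[of r "max r q"] pad[of q "max r q"] by (simp add: distrib_right sum.distrib)
    then show "u + v \<in> finite_combinations a" using finite_combinationsI by metis
  next
    fix c v assume "v \<in> finite_combinations a"
    then obtain d q where v: "v = (\<lambda>n. \<Sum>i<q. d i * a i n)" unfolding finite_combinations_def by blast
    have "dirichlet_scale c v = (\<lambda>n. \<Sum>i<q. (c * d i) * a i n)"
      by (simp add: dirichlet_scale_def v sum_distrib_left mult.assoc)
    then show "dirichlet_scale c v \<in> finite_combinations a" using finite_combinationsI by metis
  qed
qed

lemma finite_combinations_subset: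
  assumes "module.subspace dirichlet_scale W" "\<And>i. a i \<in> W"
  shows "finite_combinations a \<subseteq> W"
proof
  interpret vector_space dirichlet_scale by (rule vector_space_dirichlet_scale)
  fix v assume "v \<in> finite_combinations a"
  then obtain c r where v: "v = (\<lambda>n. \<Sum>i<r. c i * a i n)" unfolding finite_combinations_def by blast
  have "v = (\<Sum>i<r. dirichlet_scale (c i) (a i))"
    unfolding v by (induction r) (simp_all add: fun_eq_iff dirichlet_scale_def)
  also have "\<dots> \<in> W" using assms by (intro subspace_sum subspace_scale) auto
  finally show "v \<in> W" .
qed

text \<open>At a stage with exceptional index \<open>m\<close>, the partial sums of the other series nearly vanish, so the
  combination has a partial sum close to \<open>c m * rat_poly xs\<close>. To reach \<open>g\<close>, one aims at \<open>g / c m\<close>.\<close>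

lemma universal_linear_combination:
  fixes a :: "nat \<Rightarrow> nat \<Rightarrow> complex"
  assumes m: "m < r" "c m \<noteq> 0"
    and stages: "\<And>xs T. \<exists>t\<ge>T. \<exists>N>0. \<forall>i\<le>t. jets_close t (1 / (real t + 1)) (dirichlet_partial_sum (a i) N)
      (if i = m then rat_poly xs else (\<lambda>_. 0))"
  shows "universal_dirichlet (\<lambda>n. \<Sum>i<r. c i * a i n)"
proof (rule universal_dirichletI)
  fix g :: "complex \<Rightarrow> complex" and k :: nat assume g: "g holomorphic_on UNIV"
  define v where "v n = (\<Sum>i<r. c i * a i n)" for n
  define e where "e = 1 / (2 * (real k + 1))"
  have e: "e > 0" "e + e = 1 / (real k + 1)" by (auto simp: e_def field_simps)
  have "(\<lambda>s. inverse (c m) * g s) holomorphic_on UNIV" by (intro holomorphic_intros g)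
  moreover have "e / cmod (c m) > 0" using e m by simp
  ultimately obtain xs where xs: "jets_close k (e / cmod (c m)) (rat_poly xs) (\<lambda>s. inverse (c m) * g s)"
    using rat_poly_dense by blast
  have "jets_close k ((\<Sum>i\<in>{m}. cmod (c i)) * (e / cmod (c m))) (\<lambda>s. \<Sum>i\<in>{m}. c i * rat_poly xs s)
      (\<lambda>s. \<Sum>i\<in>{m}. c i * (inverse (c m) * g s))"
    by (rule jets_close_linear_combination)
      (auto intro!: holomorphic_rat_poly holomorphic_intros g xs)
  then have close_g: "jets_close k e (\<lambda>s. c m * rat_poly xs s) g"
    using m by (simp add: mult.assoc[symmetric])
  define C where "C = (\<Sum>i<r. cmod (c i))"
  obtain K :: nat where K: "C / e \<le> real K" using real_arch_simple by blast
  obtain t N where t: "t \<ge> max k (max r K)" and "N > 0"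
    and stage: "\<And>i. i \<le> t \<Longrightarrow> jets_close t (1 / (real t + 1)) (dirichlet_partial_sum (a i) N)
      (if i = m then rat_poly xs else (\<lambda>_. 0))"
    using stages[of "max k (max r K)" xs] by blast
  have "jets_close t ((\<Sum>i<r. cmod (c i)) * (1 / (real t + 1)))
      (\<lambda>s. \<Sum>i<r. c i * dirichlet_partial_sum (a i) N s)
      (\<lambda>s. \<Sum>i<r. c i * (if i = m then rat_poly xs else (\<lambda>_. 0)) s)"
    using t by (intro jets_close_linear_combination stage holomorphic_dirichlet_partial_sum)
      (auto intro: holomorphic_rat_poly)
  moreover have "(\<lambda>s. \<Sum>i<r. c i * dirichlet_partial_sum (a i) N s) = dirichlet_partial_sum v N"
    by (rule ext, simp add: dirichlet_partial_sum_def v_def sum_distrib_left sum_distrib_right mult.assoc)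
      (rule sum.swap)
  moreover have "(\<lambda>s. \<Sum>i<r. c i * (if i = m then rat_poly xs else (\<lambda>_. 0)) s) = (\<lambda>s. c m * rat_poly xs s)"
  proof
    fix s
    have "(\<Sum>i<r. c i * (if i = m then rat_poly xs else (\<lambda>_. 0)) s)
        = (\<Sum>i<r. if i = m then c i * rat_poly xs s else 0)"
      by (intro sum.cong) auto
    then show "(\<Sum>i<r. c i * (if i = m then rat_poly xs else (\<lambda>_. 0)) s) = c m * rat_poly xs s"
      using m by simp
  qed
  ultimately have "jets_close t (C * (1 / (real t + 1))) (dirichlet_partial_sum v N) (\<lambda>s. c m * rat_poly xs s)"
    by (simp add: C_def)
  moreover have "C * (1 / (real t + 1)) \<le> e"
  proof -
    have "C \<le> real K * e" using K e by (simp add: field_simps)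
    also have "\<dots> \<le> (real t + 1) * e" using t e by (intro mult_right_mono) auto
    finally show ?thesis by (simp add: field_simps)
  qed
  moreover have "k \<le> t" using t by simp
  ultimately have "jets_close k e (dirichlet_partial_sum v N) (\<lambda>s. c m * rat_poly xs s)"
    using jets_close_mono by blast
  then have "jets_close k (e + e) (dirichlet_partial_sum v N) g"
    using jets_close_triangle close_g by blast
  then show "\<exists>N>0. jets_close k (1 / (real k + 1)) (dirichlet_partial_sum (\<lambda>n. \<Sum>i<r. c i * a i n) N) g"
    using \<open>N > 0\<close> unfolding e(2) v_def by blast
qed

text \<open>The number of a stage encodes the exceptional index, the polynomial, and a third component that makes
  each combination of the first two recur at arbitrarily late stages. Similarly each rational sequence
  is the starting point \<open>p m\<close> for arbitrarily large \<open>m\<close>, for which \<open>a m\<close> stays close to \<open>p m\<close>.\<close>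

lemma dense_universal_subspace:
  obtains V where "V \<subseteq> abs_conv_dirichlet" "module.subspace dirichlet_scale V"
    and "\<And>v. v \<in> V \<Longrightarrow> v \<noteq> 0 \<Longrightarrow> universal_dirichlet v"
    and "\<And>a \<sigma> \<epsilon>. a \<in> abs_conv_dirichlet \<Longrightarrow> \<sigma> > 0 \<Longrightarrow> \<epsilon> > 0 \<Longrightarrow>
      \<exists>v\<in>V. dirichlet_seminorm \<sigma> (v - a) < \<epsilon>"
proof -
  define p :: "nat \<Rightarrow> nat \<Rightarrow> complex" where "p m = rat_seq (from_nat (fst (prod_decode m)))" for m
  define G :: "nat \<Rightarrow> nat \<Rightarrow> complex \<Rightarrow> complex" where
    "G t m = (if m = fst (prod_decode t)
      then rat_poly (from_nat (fst (prod_decode (snd (prod_decode t))))) else (\<lambda>_. 0))" for t m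
  obtain a N where a: "\<And>m. a m \<in> abs_conv_dirichlet"
    and a_p: "\<And>m. dirichlet_seminorm (1 / (real m + 1)) (a m - p m) \<le> 2 * (1/2) ^ m"
    and N: "\<And>t. N t > 0"
    and jets: "\<And>m t. m \<le> t \<Longrightarrow> jets_close t (1 / (real t + 1)) (dirichlet_partial_sum (a m) (N t)) (G t m)"
  proof (rule dirichlet_sequence_with_prescribed_partial_sums[of p "\<lambda>m. length (from_nat (fst (prod_decode m)) :: (rat \<times> rat) list)" G])
    show "p m 0 = 0" for m by (simp add: p_def rat_seq_def)
    show "n \<le> length (from_nat (fst (prod_decode m)) :: (rat \<times> rat) list)" if "p m n \<noteq> 0" for m n
      using that by (auto simp: p_def rat_seq_def split: if_splits)
    show "G t m holomorphic_on UNIV" for t m by (auto simp: G_def holomorphic_rat_poly)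
  qed blast
  show ?thesis
  proof (rule that[of "finite_combinations a"])
    show "finite_combinations a \<subseteq> abs_conv_dirichlet"
      by (rule finite_combinations_subset[OF subspace_abs_conv_dirichlet a])
    show "module.subspace dirichlet_scale (finite_combinations a)" by (rule subspace_finite_combinations)
  next
    fix v assume "v \<in> finite_combinations a" "v \<noteq> 0"
    then obtain c r where v: "v = (\<lambda>n. \<Sum>i<r. c i * a i n)" unfolding finite_combinations_def by blast
    have "\<exists>m<r. c m \<noteq> 0"
    proof (rule ccontr)
      assume "\<not> (\<exists>m<r. c m \<noteq> 0)"
      then have "v = 0" unfolding v by (intro ext) (simp add: zero_fun_def)
      then show False using \<open>v \<noteq> 0\<close> by simp
    qed
    then obtain m where m: "m < r" "c m \<noteq> 0" by blast
    have "\<exists>t\<ge>T. \<exists>N>0. \<forall>i\<le>t. jets_close t (1 / (real t + 1)) (dirichlet_partial_sum (a i) N)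
        (if i = m then rat_poly xs else (\<lambda>_. 0))" for xs T
    proof -
      define t where "t = prod_encode (m, prod_encode (to_nat xs, T))"
      have "T \<le> t" unfolding t_def by (rule order_trans[OF le_prod_encode_2 le_prod_encode_2])
      moreover have "G t i = (if i = m then rat_poly xs else (\<lambda>_. 0))" for i
        by (simp add: G_def t_def)
      moreover have "jets_close t (1 / (real t + 1)) (dirichlet_partial_sum (a i) (N t)) (G t i)"
        if "i \<le> t" for i by (rule jets[OF that])
      ultimately have "t \<ge> T \<and> N t > 0 \<and> (\<forall>i\<le>t. jets_close t (1 / (real t + 1))
          (dirichlet_partial_sum (a i) (N t)) (if i = m then rat_poly xs else (\<lambda>_. 0)))"
        using N[of t] by simp
      then show ?thesis by blast
    qed
    then show "universal_dirichlet v" unfolding v by (intro universal_linear_combination[of m r c] m) blast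
  next
    fix b :: "nat \<Rightarrow> complex" and \<sigma> \<epsilon> :: real assume b: "b \<in> abs_conv_dirichlet" and \<sigma>: "\<sigma> > 0" and \<epsilon>: "\<epsilon> > 0"
    have half: "\<epsilon>/2 > 0" using \<epsilon> by simp
    obtain xs where xs: "dirichlet_seminorm \<sigma> (rat_seq xs - b) < \<epsilon>/2" using rat_seq_dense[OF b \<sigma> half] .
    have "(\<lambda>n. 2 * (1/2) ^ n) \<longlonglongrightarrow> (0 :: real)"
      by (intro tendsto_mult_right_zero LIMSEQ_power_zero) simp
    then have "\<forall>\<^sub>F n in sequentially. 2 * (1/2) ^ n < \<epsilon>/2" using half by (rule order_tendstoD)
    then obtain J where J: "\<And>n. n \<ge> J \<Longrightarrow> 2 * (1/2) ^ n < \<epsilon>/2"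
      unfolding eventually_sequentially by blast
    obtain J' :: nat where J': "1 / \<sigma> \<le> real J'" using real_arch_simple by blast
    define m where "m = prod_encode (to_nat xs, max J J')"
    have m: "max J J' \<le> m" unfolding m_def by (rule le_prod_encode_2)
    have p: "p m = rat_seq xs" by (simp add: p_def m_def)
    have "1 / \<sigma> \<le> real m + 1" using J' m by simp
    then have le: "1 / (real m + 1) \<le> \<sigma>" using \<sigma> by (simp add: field_simps)
    have "dirichlet_seminorm \<sigma> (a m - b) \<le> dirichlet_seminorm \<sigma> (a m - p m) + dirichlet_seminorm \<sigma> (p m - b)"
      using b a \<sigma> by (intro dirichlet_seminorm_triangle) (auto simp: p rat_seq_abs_conv_dirichlet)
    also have "dirichlet_seminorm \<sigma> (a m - p m) \<le> dirichlet_seminorm (1 / (real m + 1)) (a m - p m)"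
      by (rule dirichlet_seminorm_antimono[OF abs_conv_dirichlet_diff _ le])
        (simp_all add: a p rat_seq_abs_conv_dirichlet)
    also have "\<dots> < \<epsilon>/2" using a_p[of m] J[of m] m by simp
    finally have "dirichlet_seminorm \<sigma> (a m - b) < \<epsilon>" using xs unfolding p by linarith
    then show "\<exists>v\<in>finite_combinations a. dirichlet_seminorm \<sigma> (v - b) < \<epsilon>"
      using finite_combinations_member by blast
  qed
qed

lemma closure_of_abs_conv_dirichlet_topology:
  assumes "\<And>a \<sigma> \<epsilon>. a \<in> abs_conv_dirichlet \<Longrightarrow> \<sigma> > 0 \<Longrightarrow> \<epsilon> > 0 \<Longrightarrow>
      \<exists>v\<in>V. v \<in> abs_conv_dirichlet \<and> dirichlet_seminorm \<sigma> (v - a) < \<epsilon>"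
  shows "abs_conv_dirichlet_topology closure_of V = abs_conv_dirichlet"
proof -
  have "V \<inter> U \<noteq> {}" if U: "openin abs_conv_dirichlet_topology U" "U \<noteq> {}" for U
  proof -
    obtain a where a: "a \<in> U" using U by blast
    then obtain \<sigma> \<epsilon> where "\<sigma> > 0" "\<epsilon> > 0"
      "\<forall>b\<in>abs_conv_dirichlet. dirichlet_seminorm \<sigma> (b - a) < \<epsilon> \<longrightarrow> b \<in> U"
      using U(1) unfolding openin_abs_conv_dirichlet_topology by blast
    moreover have "a \<in> abs_conv_dirichlet"
      using a U(1) unfolding openin_abs_conv_dirichlet_topology by blast
    ultimately show ?thesis using assms by blast
  qed
  then show ?thesis
    using dense_intersects_open[of abs_conv_dirichlet_topology V] by simp
qed

text \<open>The space has no isolated points, so the zero series may be left out of a dense subspace.\<close>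

lemma dense_subspace_nonzero:
  assumes V: "module.subspace dirichlet_scale V" "V \<subseteq> abs_conv_dirichlet"
    and dense: "\<And>a \<sigma> \<epsilon>. a \<in> abs_conv_dirichlet \<Longrightarrow> \<sigma> > 0 \<Longrightarrow> \<epsilon> > 0 \<Longrightarrow>
      \<exists>v\<in>V. dirichlet_seminorm \<sigma> (v - a) < \<epsilon>"
    and a: "a \<in> abs_conv_dirichlet" and \<sigma>: "\<sigma> > 0" and \<epsilon>: "\<epsilon> > 0"
  shows "\<exists>v\<in>V. v \<noteq> 0 \<and> dirichlet_seminorm \<sigma> (v - a) < \<epsilon>"
proof -
  \<comment> \<open>Near \<open>a = 0\<close>, a nonzero element is found by approximating \<open>d\<close>, which has norm \<open>\<epsilon> / 2\<close>.\<close>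
  define d :: "nat \<Rightarrow> complex" where "d n = (if n = 1 then of_real (\<epsilon>/2) else 0)" for n
  have d: "d \<in> abs_conv_dirichlet"
    by (rule finite_support_abs_conv_dirichlet[of _ 1]) (auto simp: d_def split: if_splits)
  have norm_d: "dirichlet_seminorm \<sigma> d = \<epsilon>/2"
  proof -
    have "dirichlet_seminorm \<sigma> d = (\<Sum>n\<in>{1}. cmod (d n) * real n powr (-\<sigma>))"
      unfolding dirichlet_seminorm_def by (rule suminf_finite) (auto simp: d_def)
    then show ?thesis using \<epsilon> by (simp add: d_def)
  qed
  have zero: "(0 :: nat \<Rightarrow> complex) \<in> abs_conv_dirichlet" by (simp add: abs_conv_dirichlet_def)
  show ?thesis
  proof (cases "a = 0")
    case False
    then obtain n where n: "a n \<noteq> 0" by (auto simp: fun_eq_iff)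
    then have "n \<noteq> 0" using a by (intro notI) (simp add: abs_conv_dirichlet_def)
    define e where "e = min \<epsilon> (cmod (a n) * real n powr (-\<sigma>))"
    have "e > 0" using \<epsilon> n \<open>n \<noteq> 0\<close> by (simp add: e_def)
    then obtain v where v: "v \<in> V" "dirichlet_seminorm \<sigma> (v - a) < e" using dense[OF a \<sigma>] by blast
    have "v \<noteq> 0"
    proof
      assume "v = 0"
      then have "dirichlet_seminorm \<sigma> a < e" using v by (simp add: dirichlet_seminorm_def)
      then show False
        using sum_le_dirichlet_seminorm[OF a \<sigma>, of "{n}"] by (simp add: e_def)
    qed
    then show ?thesis using v by (auto simp: e_def)
  next
    case True
    obtain v where v: "v \<in> V" "dirichlet_seminorm \<sigma> (v - d) < \<epsilon>/2"
      using dense[OF d \<sigma>, of "\<epsilon>/2"] \<epsilon> by auto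
    have "v \<noteq> 0"
    proof
      assume "v = 0"
      then have "dirichlet_seminorm \<sigma> d < \<epsilon>/2" using v by (simp add: dirichlet_seminorm_def)
      then show False by (simp add: norm_d)
    qed
    moreover have "v \<in> abs_conv_dirichlet" using v V by blast
    then have "dirichlet_seminorm \<sigma> (v - 0) \<le> dirichlet_seminorm \<sigma> (v - d) + dirichlet_seminorm \<sigma> (d - 0)"
      by (rule dirichlet_seminorm_triangle[OF zero d _ \<sigma>])
    ultimately show ?thesis using v True norm_d by (intro bexI[of _ v]) auto
  qed
qed

theorem theorem3p6:
  shows "(\<exists>a \<in> abs_conv_dirichlet. universal_dirichlet a) \<and>
    abs_conv_dirichlet_topology closure_of {a \<in> abs_conv_dirichlet. universal_dirichlet a}
      = abs_conv_dirichlet \<and>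
    gdelta_in abs_conv_dirichlet_topology {a \<in> abs_conv_dirichlet. universal_dirichlet a} \<and>
    (\<exists>V. V \<subseteq> abs_conv_dirichlet \<and>
       module.subspace dirichlet_scale V \<and>
       abs_conv_dirichlet_topology closure_of V = abs_conv_dirichlet \<and>
       (\<forall>a\<in>V. a \<noteq> 0 \<longrightarrow> universal_dirichlet a))"
proof -
  obtain V where V: "V \<subseteq> abs_conv_dirichlet" "module.subspace dirichlet_scale V"
    and univ: "\<And>v. v \<in> V \<Longrightarrow> v \<noteq> 0 \<Longrightarrow> universal_dirichlet v"
    and dense: "\<And>a \<sigma> \<epsilon>. a \<in> abs_conv_dirichlet \<Longrightarrow> \<sigma> > 0 \<Longrightarrow> \<epsilon> > 0 \<Longrightarrow>
      \<exists>v\<in>V. dirichlet_seminorm \<sigma> (v - a) < \<epsilon>"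
    by (rule dense_universal_subspace) blast
  have nonzero: "\<exists>v\<in>V. v \<noteq> 0 \<and> dirichlet_seminorm \<sigma> (v - a) < \<epsilon>"
    if "a \<in> abs_conv_dirichlet" "\<sigma> > 0" "\<epsilon> > 0" for a \<sigma> \<epsilon>
    by (rule dense_subspace_nonzero[OF V(2,1) dense that])
  have V_dense: "abs_conv_dirichlet_topology closure_of V = abs_conv_dirichlet"
    using dense V(1) by (intro closure_of_abs_conv_dirichlet_topology) blast
  have U_dense: "abs_conv_dirichlet_topology closure_of {a \<in> abs_conv_dirichlet. universal_dirichlet a}
      = abs_conv_dirichlet"
    using nonzero V(1) univ by (intro closure_of_abs_conv_dirichlet_topology) blast
  have "(0 :: nat \<Rightarrow> complex) \<in> abs_conv_dirichlet" by (simp add: abs_conv_dirichlet_def)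
  then obtain v where "v \<in> V" "v \<noteq> 0" using nonzero[of 0 1 1] by auto
  then have ex: "\<exists>a\<in>abs_conv_dirichlet. universal_dirichlet a" using V(1) univ by blast
  show ?thesis
    using ex U_dense gdelta_in_universal_dirichlet V V_dense univ by (intro conjI exI[of _ V]) auto
qed

end
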